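(* Let $A$ be a finite set with $q:=|A|\ge 2$ and let $n\ge 2$. For $2\le l\le n$ let $G_l$ be the subgroup of $\mathrm{Sym}(A^n)$ generated by all $l$-ary instructions. Then: (i) for any $n$, $G_n=\mathrm{Sym}(A^n)$; (ii) if $q=2$ (identifying $A$ with $\mathrm{GF}(2)$), then $G_2=\mathrm{Aff}(n,2)$ for all $n$, and $G_3=G_{n-1}=\mathrm{Alt}(A^n)$ for $n\ge 4$; (iii) if $n\ge 3$ and $q\ge 3$ is odd, then $G_2=G_{n-1}=\mathrm{Sym}(A^n)$; (iv) if $n\ge 3$ and $q\ge 4$ is even, then $G_2=G_{n-1}=\mathrm{Alt}(A^n)$.
   Context: Any $f\in\mathrm{Sym}(A^n)$ is written $f(x)=(f_1(x),\ldots,f_n(x))$ with coordinate functions $f_i:A^n\to A$; the $i$-th coordinate function is trivial if $f_i(x)=x_i$ for all $x$. An instruction is a permutation of $A^n$ with at most one nontrivial coordinate function (the identity counts as an instruction). A coordinate function $f_j$ is $l$-ary if it depends on at most $l$ of the variables, i.e. $f_j(x)=h(x_{k_1},\ldots,x_{k_l})$ for some $k_1,\ldots,k_l\in\{1,\ldots,n\}$ and some $h:A^l\to A$; an $l$-ary instruction is an instruction whose coordinate functions are all $l$-ary. $\mathrm{Aff}(n,2)$ denotes the affine group of $\mathrm{GF}(2)^n$ (maps $x\mapsto Mx+b$ with $M\in\mathrm{GL}(n,2)$, $b\in\mathrm{GF}(2)^n$). *)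

theory Defs
  imports "HOL-Combinatorics.Permutations" "HOL-Library.Z2"
begin

definition cube :: "'a set \<Rightarrow> nat \<Rightarrow> 'a list set" where
  "cube A n = {xs. length xs = n \<and> set xs \<subseteq> A}"

definition SymC :: "'a set \<Rightarrow> nat \<Rightarrow> ('a list \<Rightarrow> 'a list) set" where
  "SymC A n = {f. f permutes cube A n}"

definition AltC :: "'a set \<Rightarrow> nat \<Rightarrow> ('a list \<Rightarrow> 'a list) set" where
  "AltC A n = {f. f permutes cube A n \<and> evenperm f}"

definition is_instruction :: "'a set \<Rightarrow> nat \<Rightarrow> ('a list \<Rightarrow> 'a list) \<Rightarrow> bool" where
  "is_instruction A n f \<longleftrightarrow> f permutes cube A n \<and>
     (\<exists>i<n. \<forall>x\<in>cube A n. \<forall>j<n. j \<noteq> i \<longrightarrow> f x ! j = x ! j)"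

definition coord_lary :: "'a set \<Rightarrow> nat \<Rightarrow> nat \<Rightarrow> ('a list \<Rightarrow> 'a list) \<Rightarrow> nat \<Rightarrow> bool" where
  "coord_lary A n l f j \<longleftrightarrow>
     (\<exists>ks h. length ks = l \<and> set ks \<subseteq> {..<n} \<and>
        (\<forall>x\<in>cube A n. f x ! j = h (map (\<lambda>k. x ! k) ks)))"

definition lary_instruction :: "'a set \<Rightarrow> nat \<Rightarrow> nat \<Rightarrow> ('a list \<Rightarrow> 'a list) \<Rightarrow> bool" where
  "lary_instruction A n l f \<longleftrightarrow> is_instruction A n f \<and> (\<forall>j<n. coord_lary A n l f j)"

inductive_set gen_perm_group :: "('b \<Rightarrow> 'b) set \<Rightarrow> ('b \<Rightarrow> 'b) set" for S where
  gen_id: "id \<in> gen_perm_group S"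
| gen_incl: "f \<in> S \<Longrightarrow> f \<in> gen_perm_group S"
| gen_comp: "f \<in> gen_perm_group S \<Longrightarrow> g \<in> gen_perm_group S \<Longrightarrow> f \<circ> g \<in> gen_perm_group S"
| gen_inv: "f \<in> gen_perm_group S \<Longrightarrow> inv f \<in> gen_perm_group S"

definition G :: "'a set \<Rightarrow> nat \<Rightarrow> nat \<Rightarrow> ('a list \<Rightarrow> 'a list) set" where
  "G A n l = gen_perm_group {f. lary_instruction A n l f}"

text \<open>Aff(n,2), transported to A^n via the identification a0 \<mapsto> 0, a1 \<mapsto> 1 of A = {a0,a1}
  with GF(2) (type bit). Matrices are nat \<Rightarrow> nat \<Rightarrow> bit with indices < n.\<close>
definition enc2 :: "'a \<Rightarrow> 'a \<Rightarrow> bit" where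
  "enc2 a1 a = (if a = a1 then 1 else 0)"

definition dec2 :: "'a \<Rightarrow> 'a \<Rightarrow> bit \<Rightarrow> 'a" where
  "dec2 a0 a1 b = (if b = 1 then a1 else a0)"

definition invertible2 :: "nat \<Rightarrow> (nat \<Rightarrow> nat \<Rightarrow> bit) \<Rightarrow> bool" where
  "invertible2 n M \<longleftrightarrow> (\<exists>N. \<forall>i<n. \<forall>k<n.
      (\<Sum>j<n. N i j * M j k) = (if i = k then 1 else 0))"

definition AffC :: "'a \<Rightarrow> 'a \<Rightarrow> nat \<Rightarrow> ('a list \<Rightarrow> 'a list) set" where
  "AffC a0 a1 n = {f. f permutes cube {a0, a1} n \<and>
     (\<exists>M b. invertible2 n M \<and>
        (\<forall>x\<in>cube {a0, a1} n. f x =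
           map (\<lambda>i. dec2 a0 a1 ((\<Sum>j<n. M i j * enc2 a1 (x ! j)) + b i)) [0..<n]))}"

end

theory Submission
  imports Defs
begin

text \<open>
  A subgroup of the symmetric group of a finite set contains the alternating group as soon as any
  two points lie in a common three-cycle of the subgroup, and this relation between points is
  transitive. On the cube it therefore suffices to treat points differing in one coordinate.

  For \<open>q \<ge> 3\<close> a three-cycle is the commutator of a transposition and itself, so commutators of
  controlled instructions add one control at a time and turn binary instructions into a
  three-cycle of points on a line. For \<open>q = 2\<close> commutators of toggles on different coordinates
  yield products of two transpositions; two of these having a single moved point in common have a
  three-cycle as commutator.

  For even \<open>q\<close> an instruction ignoring some coordinate acts in the same way on the two halves of
  the cube given by that coordinate, hence is even; for odd \<open>q\<close> a transposition of one coordinate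
  is odd. Over \<open>GF(2)\<close> a permutation is affine iff it preserves \<open>x + y + z\<close>, which binary
  instructions do, and Gaussian elimination provides the converse inclusion.
\<close>

section \<open>Groups of permutations of a finite set\<close>

text \<open>Written as a product of transpositions, it inherits conjugation from
  \<open>transpose_conj\<close>. It is the cycle x to y to z to x only for distinct points, hence
  the recurring \<open>distinct\<close> assumptions.\<close>

definition three_cycle :: "'b \<Rightarrow> 'b \<Rightarrow> 'b \<Rightarrow> 'b \<Rightarrow> 'b" where
  "three_cycle x y z = transpose x y \<circ> transpose y z"

lemma three_cycle_apply:
  assumes "distinct [x, y, z]"
  shows "three_cycle x y z u = (if u = x then y else if u = y then z else if u = z then x else u)"
  using assms by (auto simp: three_cycle_def transpose_def)

lemma three_cycle_rotate:
  assumes "distinct [x, y, z]"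
  shows "three_cycle x y z = three_cycle y z x"
proof -
  have "distinct [y, z, x]"
    using assms by auto
  then show ?thesis
    using assms by (auto simp: fun_eq_iff three_cycle_apply)
qed

lemma inv_three_cycle:
  "inv (three_cycle x y z) = three_cycle z y x"
  by (rule inv_unique_comp)
    (simp_all add: three_cycle_def fun_eq_iff transpose_commute[of z y] transpose_commute[of y x])

lemma transpose_conj:
  assumes "bij g"
  shows "g \<circ> transpose x y \<circ> inv g = transpose (g x) (g y)"
proof
  fix u
  obtain w where "u = g w"
    using assms by (metis bij_pointE)
  with assms show "(g \<circ> transpose x y \<circ> inv g) u = transpose (g x) (g y) u"
    by (auto simp: transpose_def bij_is_inj inj_eq)
qed

lemma three_cycle_conj:
  assumes "bij g"
  shows "g \<circ> three_cycle x y z \<circ> inv g = three_cycle (g x) (g y) (g z)"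
proof -
  have "g \<circ> three_cycle x y z \<circ> inv g = (g \<circ> transpose x y \<circ> inv g) \<circ> (g \<circ> transpose y z \<circ> inv g)"
    using assms by (auto simp: three_cycle_def fun_eq_iff bij_is_inj)
  then show ?thesis
    by (simp only: transpose_conj[OF assms] three_cycle_def)
qed

text \<open>No point besides \<open>a\<close> is moved by both maps, so \<open>g\<close> fixes
  \<open>f a\<close> and \<open>f\<close> fixes \<open>g a\<close>. The two orders of composition
  then differ only at \<open>a\<close> and at its preimages under \<open>f\<close> and
  \<open>g\<close>, which produces the cycle.\<close>

lemma commutator_single_common_moved_point:
  assumes f: "bij f" and g: "bij g"
    and moved: "\<And>x. f x \<noteq> x \<and> g x \<noteq> x \<longleftrightarrow> x = a"
  shows "f \<circ> g \<circ> inv f \<circ> inv g = three_cycle a (f a) (g a)"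
    and "distinct [a, f a, g a]"
proof -
  have fa: "f a \<noteq> a" and ga: "g a \<noteq> a"
    using moved by auto
  have injs: "f x = f y \<longleftrightarrow> x = y" "g x = g y \<longleftrightarrow> x = y" for x y
    using f g by (auto simp: bij_is_inj inj_eq)
  have g_fa: "g (f a) = f a" and f_ga: "f (g a) = g a"
    using moved[of "f a"] moved[of "g a"] fa ga injs by auto
  show dist: "distinct [a, f a, g a]"
    using fa ga g_fa by (auto simp: injs)
  show "f \<circ> g \<circ> inv f \<circ> inv g = three_cycle a (f a) (g a)"
  proof
    fix u
    \<comment> \<open>With \<open>u = g (f w)\<close> the claim compares the two orders of
      composition and is free of inverses.\<close>
    have "f (g w) = three_cycle a (f a) (g a) (g (f w))" for w
    proof -
      consider "w = a" | "f w = a" | "g w = a" | "w \<noteq> a" "f w \<noteq> a" "g w \<noteq> a"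
        by blast
      then show ?thesis
      proof cases
        case 1
        then show ?thesis using g_fa f_ga dist by (auto simp: three_cycle_apply)
      next
        case 2
        then have "g w = w"
          using moved[of w] fa by auto
        with 2 show ?thesis using dist by (auto simp: three_cycle_apply)
      next
        case 3
        then have "f w = w"
          using moved[of w] ga by auto
        with 3 show ?thesis using dist by (auto simp: three_cycle_apply)
      next
        case 4
        have "f w = w \<or> g w = w"
          using 4 moved by auto
        then have "f (g w) = g (f w)"
          using 4 moved[of "f w"] moved[of "g w"] injs by metis
        moreover have "g (f w) \<noteq> a"
          using calculation 4 moved[of w] by metis
        moreover have "g (f w) \<noteq> f a"
          using 4 g_fa by (metis injs)
        moreover have "g (f w) \<noteq> g a"
          using 4 by (simp add: injs)
        ultimately show ?thesis
          using dist by (simp add: three_cycle_apply)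
      qed
    qed
    from this[of "inv f (inv g u)"]
    show "(f \<circ> g \<circ> inv f \<circ> inv g) u = three_cycle a (f a) (g a) u"
      using f g by (simp add: bij_is_surj surj_f_inv_f)
  qed
qed

section \<open>Subgroups in which all points are linked by three-cycles\<close>

locale perm_group =
  fixes X :: "'b set" and H :: "('b \<Rightarrow> 'b) set"
  assumes finite_X: "finite X"
    and permutes: "f \<in> H \<Longrightarrow> f permutes X"
    and id_mem: "id \<in> H"
    and comp_mem: "f \<in> H \<Longrightarrow> g \<in> H \<Longrightarrow> f \<circ> g \<in> H"
    and inv_mem: "f \<in> H \<Longrightarrow> inv f \<in> H"
begin

lemma bij: "f \<in> H \<Longrightarrow> bij f"
  using permutes permutes_bij by blast

lemma conj_mem: "f \<in> H \<Longrightarrow> g \<in> H \<Longrightarrow> g \<circ> f \<circ> inv g \<in> H"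
  by (simp add: comp_mem inv_mem)

lemma three_cycle_conj_mem:
  assumes "three_cycle x y z \<in> H" "g \<in> H"
  shows "three_cycle (g x) (g y) (g z) \<in> H"
  using conj_mem[OF assms] three_cycle_conj[OF bij[OF assms(2)]] by simp

lemma three_cycle_inv_mem: "three_cycle x y z \<in> H \<Longrightarrow> three_cycle z y x \<in> H"
  using inv_mem inv_three_cycle by metis

definition linked :: "'b \<Rightarrow> 'b \<Rightarrow> bool" where
  "linked x y \<longleftrightarrow> x = y \<or> (\<exists>z. distinct [x, y, z] \<and> three_cycle x y z \<in> H)"

lemma linked_refl: "linked x x"
  by (simp add: linked_def)

text \<open>If the cycle through \<open>y\<close> and \<open>w\<close> fixes \<open>x\<close>,
  conjugation by it carries a cycle through \<open>x\<close> and \<open>y\<close> to one through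
  \<open>x\<close> and \<open>w\<close>. Otherwise \<open>x\<close> is its third point, and its
  inverse sends \<open>x\<close> to \<open>w\<close>.\<close>

lemma linked_trans:
  assumes "linked x y" "linked y w"
  shows "linked x w"
proof (cases "x = y \<or> y = w \<or> x = w")
  case True
  then show ?thesis
    using assms by (auto simp: linked_def)
next
  case False
  obtain z v where z: "distinct [x, y, z]" "three_cycle x y z \<in> H"
    and v: "distinct [y, w, v]" "three_cycle y w v \<in> H"
    using assms False by (auto simp: linked_def)
  show ?thesis
  proof (cases "v = x")
    case True
    have "three_cycle x w y \<in> H"
      using three_cycle_inv_mem[OF v(2)] True by simp
    then show ?thesis
      using False by (auto simp: linked_def)
  next
    case v_x: False
    let ?g = "three_cycle y w v"
    have g: "?g x = x" "?g y = w"
      using v v_x False z by (auto simp: three_cycle_apply)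
    have "distinct [?g x, ?g y, ?g z]"
      using z(1) bij[OF v(2)] by (auto simp: bij_is_inj inj_eq)
    with three_cycle_conj_mem[OF z(2) v(2)] g show ?thesis
      unfolding linked_def by metis
  qed
qed

text \<open>Linking gives a cycle through \<open>x\<close> and \<open>y\<close> with some arbitrary
  third point \<open>u\<close>. Conjugating by a cycle through \<open>u\<close> and \<open>z\<close>
  replaces \<open>u\<close> by \<open>z\<close>; if that cycle also meets \<open>x\<close> or
  \<open>y\<close>, its inverse is used and the result is inverted.\<close>

lemma three_cycle_mem_if_linked:
  assumes linked: "\<And>x y. x \<in> X \<Longrightarrow> y \<in> X \<Longrightarrow> linked x y"
    and "x \<in> X" "y \<in> X" "z \<in> X" and dist: "distinct [x, y, z]"
  shows "three_cycle x y z \<in> H"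
proof -
  obtain u where u: "distinct [x, y, u]" "three_cycle x y u \<in> H"
    using linked[of x y] assms by (auto simp: linked_def)
  show ?thesis
  proof (cases "u = z")
    case True
    then show ?thesis using u by simp
  next
    case False
    have "u \<in> X"
      using permutes[OF u(2)] u(1) \<open>y \<in> X\<close> permutes_in_image[of "three_cycle x y u" X y]
      by (auto simp: three_cycle_apply split: if_splits)
    then obtain v where v: "distinct [u, z, v]" "three_cycle u z v \<in> H"
      using linked[of u z] assms False by (auto simp: linked_def)
    let ?g = "three_cycle u z v" and ?g' = "three_cycle v z u"
    have v': "distinct [v, z, u]" "three_cycle v z u \<in> H"
      using v three_cycle_inv_mem by auto
    consider "v \<noteq> x" "v \<noteq> y" | "v = x" | "v = y"
      by blast
    then show ?thesis
    proof cases
      case 1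
      have "?g x = x" "?g y = y" "?g u = z"
        using 1 u v dist by (auto simp: three_cycle_apply)
      then show ?thesis
        using three_cycle_conj_mem[OF u(2) v(2)] by simp
    next
      case 2
      have "?g' x = z" "?g' y = y" "?g' u = x"
        using 2 u v' dist by (auto simp: three_cycle_apply)
      then show ?thesis
        using three_cycle_conj_mem[OF u(2) v'(2)] three_cycle_inv_mem by metis
    next
      case 3
      have "?g' x = x" "?g' y = z" "?g' u = y"
        using 3 u v' dist by (auto simp: three_cycle_apply)
      then have "three_cycle y z x \<in> H"
        using three_cycle_conj_mem[OF u(2) v'(2)] three_cycle_inv_mem by metis
      then show ?thesis
        using three_cycle_rotate dist by metis
    qed
  qed
qed

text \<open>Inserting \<open>transpose b c\<close> twice splits the product into two products of
  transpositions sharing a point, each of which is the identity or a three-cycle.\<close>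

lemma transpose_transpose_mem_if_linked:
  assumes linked: "\<And>x y. x \<in> X \<Longrightarrow> y \<in> X \<Longrightarrow> linked x y"
    and mem: "a \<in> X" "b \<in> X" "c \<in> X" "d \<in> X" and "a \<noteq> b" "c \<noteq> d"
  shows "transpose a b \<circ> transpose c d \<in> H"
proof -
  have path: "transpose x y \<circ> transpose y z \<in> H"
    if "x \<in> X" "y \<in> X" "z \<in> X" "x \<noteq> y" "y \<noteq> z" for x y z
  proof (cases "x = z")
    case True
    then show ?thesis
      using id_mem by (simp add: transpose_commute[of z y])
  next
    case False
    then show ?thesis
      using three_cycle_mem_if_linked[OF linked, of x y z] that by (simp add: three_cycle_def)
  qed
  show ?thesis
  proof (cases "b = c")
    case True
    then show ?thesis
      using path[of a b d] assms by simp
  next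
    case False
    have "(transpose a b \<circ> transpose b c) \<circ> (transpose b c \<circ> transpose c d) \<in> H"
      using comp_mem path[of a b c] path[of b c d] assms False by simp
    then show ?thesis
      by (simp add: comp_def)
  qed
qed

lemma even_mem_if_linked:
  assumes linked: "\<And>x y. x \<in> X \<Longrightarrow> y \<in> X \<Longrightarrow> linked x y"
    and p: "p permutes X" "evenperm p"
  shows "p \<in> H"
proof (cases "\<exists>a b. a \<in> X \<and> b \<in> X \<and> a \<noteq> b")
  case False
  have "p x = x" for x
  proof (cases "x \<in> X")
    case True
    then show ?thesis
      using False permutes_in_image[OF p(1)] by blast
  next
    case False
    then show ?thesis
      using p(1) by (simp add: permutes_not_in)
  qed
  then have "p = id"
    by auto
  then show ?thesis
    using id_mem by simp
next
  case True
  then obtain a b where ab: "a \<in> X" "b \<in> X" "a \<noteq> b"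
    by blast
  \<comment> \<open>A single transposition leads out of the even permutations, so the induction
    carries the odd ones along, corrected by one fixed transposition.\<close>
  have "if evenperm p then p \<in> H else transpose a b \<circ> p \<in> H"
    using p(1) finite_X
  proof (induction rule: permutes_induct)
    case id
    then show ?case
      using id_mem by simp
  next
    case (swap c d p)
    have even: "evenperm (transpose c d \<circ> p) \<longleftrightarrow> \<not> evenperm p"
      using swap finite_X permutes_imp_permutation[of X p]
      by (simp add: evenperm_comp permutation_swap_id evenperm_swap)
    show ?case
    proof (cases "evenperm p")
      case True
      then have "(transpose a b \<circ> transpose c d) \<circ> p \<in> H"
        using swap ab linked by (intro comp_mem[OF transpose_transpose_mem_if_linked]) auto
      then show ?thesis
        using True even unfolding comp_assoc by presburger
    next
      case False
      then have "(transpose c d \<circ> transpose a b) \<circ> (transpose a b \<circ> p) \<in> H"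
        using swap ab linked by (intro comp_mem[OF transpose_transpose_mem_if_linked]) auto
      moreover have "(transpose c d \<circ> transpose a b) \<circ> (transpose a b \<circ> p) = transpose c d \<circ> p"
        by (simp add: fun_eq_iff)
      ultimately show ?thesis
        using False even by metis
    qed
  qed
  then show ?thesis
    using p(2) by simp
qed

lemma all_mem_if_linked_and_odd:
  assumes linked: "\<And>x y. x \<in> X \<Longrightarrow> y \<in> X \<Longrightarrow> linked x y"
    and g: "g \<in> H" "\<not> evenperm g" and p: "p permutes X"
  shows "p \<in> H"
proof (cases "evenperm p")
  case True
  then show ?thesis
    using even_mem_if_linked linked p by blast
next
  case False
  have "evenperm (p \<circ> inv g)"
    using False g p finite_X permutes[OF g(1)] permutes_imp_permutation[of X]
    by (simp add: evenperm_comp evenperm_inv permutation_inverse)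
  then have "p \<circ> inv g \<in> H"
    using even_mem_if_linked[OF linked] permutes_compose[OF permutes[OF inv_mem[OF g(1)]] p] by blast
  then have "p \<circ> inv g \<circ> g \<in> H"
    using comp_mem g by blast
  then show ?thesis
    using permutes_inv_o(2)[OF permutes[OF g(1)]] by (simp add: comp_assoc)
qed

lemma transpose_mem_trans:
  assumes "transpose x y \<in> H" "transpose y z \<in> H"
  shows "transpose x z \<in> H"
proof (cases "x = y \<or> x = z")
  case True
  then show ?thesis
    using assms id_mem by auto
next
  case False
  have "transpose (transpose y z x) (transpose y z y) \<in> H"
    using conj_mem[OF assms] transpose_conj[OF bij[OF assms(2)]] by simp
  then show ?thesis
    using False by (auto simp: transpose_def)
qed

lemma all_mem_if_transpositions:
  assumes transp: "\<And>x y. x \<in> X \<Longrightarrow> y \<in> X \<Longrightarrow> transpose x y \<in> H"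
    and p: "p permutes X"
  shows "p \<in> H"
  using p finite_X
  by (induction rule: permutes_induct) (blast intro: id_mem comp_mem transp)+

end

section \<open>Cubes and the groups generated by instructions\<close>

lemma finite_cube: "finite A \<Longrightarrow> finite (cube A n)"
  using finite_lists_length_eq[of A n] by (simp add: cube_def conj_commute)

lemma length_cube: "x \<in> cube A n \<Longrightarrow> length x = n"
  by (simp add: cube_def)

lemma nth_cube: "x \<in> cube A n \<Longrightarrow> i < n \<Longrightarrow> x ! i \<in> A"
  by (auto simp: cube_def)

lemma list_update_cube: "x \<in> cube A n \<Longrightarrow> a \<in> A \<Longrightarrow> x[i := a] \<in> cube A n"
  using set_update_subset_insert[of x i a] by (auto simp: cube_def)

lemma cubeI: "length x = n \<Longrightarrow> (\<And>i. i < n \<Longrightarrow> x ! i \<in> A) \<Longrightarrow> x \<in> cube A n"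
  by (auto simp: cube_def in_set_conv_nth)

lemma cube_eqI:
  "x \<in> cube A n \<Longrightarrow> y \<in> cube A n \<Longrightarrow> (\<And>i. i < n \<Longrightarrow> x ! i = y ! i) \<Longrightarrow> x = y"
  by (auto simp: cube_def intro: nth_equalityI)

text \<open>The path from \<open>x\<close> to \<open>y\<close> changes one coordinate at a time,
  through the words \<open>take k y @ drop k x\<close>. Relations such as \<open>linked\<close> or
  lying in one orbit thereby reduce to two points on a common line.\<close>

lemma cube_connected:
  assumes refl: "\<And>x. x \<in> cube A n \<Longrightarrow> R x x"
    and trans: "\<And>x y z. x \<in> cube A n \<Longrightarrow> y \<in> cube A n \<Longrightarrow> z \<in> cube A n \<Longrightarrow> R x y \<Longrightarrow> R y z \<Longrightarrow> R x z"
    and step: "\<And>x i a. x \<in> cube A n \<Longrightarrow> i < n \<Longrightarrow> a \<in> A \<Longrightarrow> R x (x[i := a])"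
    and x: "x \<in> cube A n" and y: "y \<in> cube A n"
  shows "R x y"
proof -
  have len: "length x = n" "length y = n"
    using x y by (simp_all add: length_cube)
  have "take k y @ drop k x \<in> cube A n \<and> R x (take k y @ drop k x)" if "k \<le> n" for k
    using that
  proof (induction k)
    case 0
    then show ?case using refl x by simp
  next
    case (Suc k)
    have "take (Suc k) y @ drop (Suc k) x = (take k y @ drop k x)[k := y ! k]"
      using Suc.prems len
      by (intro nth_equalityI) (auto simp: nth_append nth_list_update min_def less_Suc_eq)
    moreover have "y ! k \<in> A"
      using y Suc.prems by (simp add: nth_cube)
    moreover have "take k y @ drop k x \<in> cube A n" "R x (take k y @ drop k x)"
      using Suc by simp_all
    ultimately show ?case
      using Suc.prems step[of "take k y @ drop k x" k "y ! k"]
        trans[OF x, of "take k y @ drop k x" "(take k y @ drop k x)[k := y ! k]"]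
      by (simp add: list_update_cube)
  qed
  from this[of n] show ?thesis
    using len by simp
qed

section \<open>The generated groups and their monotonicity in the arity\<close>

lemma perm_group_G:
  assumes "finite A"
  shows "perm_group (cube A n) (G A n l)"
proof
  show "f permutes cube A n" if "f \<in> G A n l" for f
    using that unfolding G_def lary_instruction_def is_instruction_def
    by induction (blast intro: permutes_compose permutes_inv permutes_id)+
qed (auto simp: G_def assms finite_cube intro: gen_perm_group.intros)

lemma gen_perm_group_subset:
  assumes "perm_group X H" "S \<subseteq> H"
  shows "gen_perm_group S \<subseteq> H"
proof
  interpret perm_group X H
    by fact
  show "f \<in> H" if "f \<in> gen_perm_group S" for f
    using that assms(2) by induction (blast intro: id_mem comp_mem inv_mem)+
qed

lemma G_subset_SymC: "finite A \<Longrightarrow> G A n l \<subseteq> SymC A n"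
  using perm_group.permutes[OF perm_group_G] by (auto simp: SymC_def)

lemma coord_lary_mono:
  assumes "coord_lary A n l f j" "l \<le> l'" "0 < n"
  shows "coord_lary A n l' f j"
proof -
  obtain ks h where ks: "length ks = l" "set ks \<subseteq> {..<n}"
    "\<forall>x\<in>cube A n. f x ! j = h (map (\<lambda>k. x ! k) ks)"
    using assms(1) by (auto simp: coord_lary_def)
  \<comment> \<open>The variable list must have length exactly \<open>l'\<close>. Padding with the
    index 0 is legitimate because \<open>0 < n\<close>, and \<open>take l\<close> discards it
    again.\<close>
  show ?thesis
    unfolding coord_lary_def
    using ks assms
    by (intro exI[of _ "ks @ replicate (l' - l) 0"] exI[of _ "\<lambda>zs. h (take l zs)"]) auto
qed

lemma G_mono:
  assumes "l \<le> l'" "0 < n"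
  shows "G A n l \<subseteq> G A n l'"
proof
  have mono: "{f. lary_instruction A n l f} \<subseteq> {f. lary_instruction A n l' f}"
    by (auto simp: lary_instruction_def intro: coord_lary_mono[OF _ assms])
  show "f \<in> G A n l'" if "f \<in> G A n l" for f
    using that mono unfolding G_def by induction (blast intro: gen_perm_group.intros)+
qed

lemma transpose_instruction:
  assumes "x \<in> cube A n" "i < n" "a \<in> A"
  shows "lary_instruction A n n (transpose x (x[i := a]))"
proof -
  let ?f = "transpose x (x[i := a])"
  have "?f permutes cube A n"
    using assms by (intro permutes_swap_id list_update_cube)
  moreover have "\<forall>z\<in>cube A n. \<forall>j<n. j \<noteq> i \<longrightarrow> ?f z ! j = z ! j"
    by (auto simp: transpose_def)
  moreover have "coord_lary A n n ?f j" for j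
    unfolding coord_lary_def
  proof (intro exI conjI ballI)
    show "length [0..<n] = n" "set [0..<n] \<subseteq> {..<n}"
      by auto
    show "?f z ! j = (\<lambda>z. ?f z ! j) (map ((!) z) [0..<n])" if "z \<in> cube A n" for z
      using map_nth[of z] length_cube[OF that] by simp
  qed
  ultimately show ?thesis
    using assms(2) by (auto simp: lary_instruction_def is_instruction_def)
qed

text \<open>Transpositions of two points on a line are n-ary instructions, and conjugating them
  along paths in the cube yields all transpositions.\<close>

lemma SymC_subset_G_full:
  assumes "finite A"
  shows "SymC A n \<subseteq> G A n n"
proof
  fix p assume "p \<in> SymC A n"
  interpret perm_group "cube A n" "G A n n"
    using assms by (rule perm_group_G)
  have "transpose x y \<in> G A n n" if "x \<in> cube A n" "y \<in> cube A n" for x y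
  proof (rule cube_connected[of A n "\<lambda>x y. transpose x y \<in> G A n n"])
    show "transpose x x \<in> G A n n" for x
      using id_mem by simp
    show "transpose x z \<in> G A n n" if "transpose x y \<in> G A n n" "transpose y z \<in> G A n n" for x y z
      using that by (rule transpose_mem_trans)
    show "transpose x (x[i := a]) \<in> G A n n" if "x \<in> cube A n" "i < n" "a \<in> A" for x i a
      unfolding G_def using transpose_instruction[OF that] by (intro gen_perm_group.gen_incl) simp
  qed fact+
  then show "p \<in> G A n n"
    using all_mem_if_transpositions \<open>p \<in> SymC A n\<close> by (simp add: SymC_def)
qed

section \<open>Controlled instructions\<close>

text \<open>The analogue of a multiply controlled gate: \<open>i\<close> is the target,
  \<open>J\<close> the set of controls and \<open>y\<close> the pattern they must show. More
  controls mean a smaller support. The test for the cube keeps the map trivial outside, as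
  \<open>permutes\<close> requires.\<close>

definition ctrl :: "'a set \<Rightarrow> nat \<Rightarrow> nat \<Rightarrow> ('a \<Rightarrow> 'a) \<Rightarrow> nat set \<Rightarrow> (nat \<Rightarrow> 'a) \<Rightarrow> 'a list \<Rightarrow> 'a list" where
  "ctrl A n i \<sigma> J y x =
     (if x \<in> cube A n \<and> (\<forall>j\<in>J. x ! j = y j) then x[i := \<sigma> (x ! i)] else x)"

lemma ball_nth_list_update:
  "i \<notin> J \<Longrightarrow> (\<forall>j\<in>J. x[i := v] ! j = y j) \<longleftrightarrow> (\<forall>j\<in>J. x ! j = y j)"
  by (metis nth_list_update_neq)

lemma ctrl_cube:
  assumes "\<sigma> permutes A" "i < n" "x \<in> cube A n"
  shows "ctrl A n i \<sigma> J y x \<in> cube A n"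
  using assms by (auto simp: ctrl_def permutes_in_image intro!: list_update_cube nth_cube)

lemma ctrl_outside: "x \<notin> cube A n \<Longrightarrow> ctrl A n i \<sigma> J y x = x"
  by (simp add: ctrl_def)

lemma nth_ctrl:
  assumes "x \<in> cube A n" "i < n"
  shows "ctrl A n i \<sigma> J y x ! j =
    (if j = i \<and> (\<forall>j\<in>J. x ! j = y j) then \<sigma> (x ! i) else x ! j)"
  using assms by (auto simp: ctrl_def length_cube)

lemma ctrl_comp:
  assumes "\<rho> permutes A" "i < n" "i \<notin> J"
  shows "ctrl A n i \<sigma> J y \<circ> ctrl A n i \<rho> J y = ctrl A n i (\<sigma> \<circ> \<rho>) J y"
proof
  fix x
  show "(ctrl A n i \<sigma> J y \<circ> ctrl A n i \<rho> J y) x = ctrl A n i (\<sigma> \<circ> \<rho>) J y x"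
    using assms
    by (auto simp: ctrl_def ball_nth_list_update length_cube list_update_cube nth_cube permutes_in_image)
qed

lemma ctrl_id: "ctrl A n i id J y = id"
  by (auto simp: ctrl_def)

lemma inv_ctrl:
  assumes "\<sigma> permutes A" "i < n" "i \<notin> J"
  shows "inv (ctrl A n i \<sigma> J y) = ctrl A n i (inv \<sigma>) J y"
  using assms by (intro inv_unique_comp)
    (simp_all add: ctrl_comp permutes_inv permutes_inv_o[OF assms(1)] ctrl_id)

lemma ctrl_permutes:
  assumes "\<sigma> permutes A" "i < n" "i \<notin> J"
  shows "ctrl A n i \<sigma> J y permutes cube A n"
proof (rule bij_imp_permutes)
  let ?f = "ctrl A n i \<sigma> J y" and ?g = "ctrl A n i (inv \<sigma>) J y"
  have "?g \<circ> ?f = id" "?f \<circ> ?g = id"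
    using assms by (simp_all add: ctrl_comp permutes_inv permutes_inv_o[OF assms(1)] ctrl_id)
  then show "bij_betw ?f (cube A n) (cube A n)"
    using assms
    by (intro bij_betw_byWitness[of _ ?g]) (auto simp: fun_eq_iff intro: ctrl_cube permutes_inv)
qed (simp add: ctrl_outside)

lemma ctrl_mem_G:
  assumes \<sigma>: "\<sigma> permutes A" and i: "i < n" "i \<notin> J" and J: "J \<subseteq> {..<n}" "card J < l"
  shows "ctrl A n i \<sigma> J y \<in> G A n l"
proof -
  let ?f = "ctrl A n i \<sigma> J y"
  have "finite J"
    using J(1) finite_subset by blast
  define ks where "ks = sorted_list_of_set J"
  have ks: "set ks = J" "length ks = card J"
    using \<open>finite J\<close> by (simp_all add: ks_def)
  have "coord_lary A n l ?f j" if "j < n" for j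
  proof (cases "j = i")
    case True
    \<comment> \<open>The target value comes first, then the values at the controls; the list is
      filled up with \<open>i\<close> to length \<open>l\<close>, and \<open>take\<close> drops the
      filling.\<close>
    let ?h = "\<lambda>zs. if map y ks = take (card J) (tl zs) then \<sigma> (hd zs) else hd zs"
    have "?f x ! i = ?h (map ((!) x) (i # ks @ replicate (l - Suc (card J)) i))" if "x \<in> cube A n" for x
      using that i ks(2) by (auto simp: nth_ctrl simp flip: ks(1))
    moreover have "length (i # ks @ replicate (l - Suc (card J)) i) = l"
      using ks J by simp
    moreover have "set (i # ks @ replicate (l - Suc (card J)) i) \<subseteq> {..<n}"
      using ks J i by auto
    ultimately show ?thesis
      unfolding coord_lary_def True by (intro exI[of _ "i # ks @ replicate (l - Suc (card J)) i"] exI[of _ ?h]) blast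
  next
    case False
    \<comment> \<open>An untouched coordinate is read from \<open>l\<close> copies of its own index;
      \<open>card J < l\<close> makes this list nonempty.\<close>
    have "?f x ! j = hd (map ((!) x) (replicate l j))" if "x \<in> cube A n" for x
      using that False i J by (cases l) (auto simp: nth_ctrl)
    moreover have "length (replicate l j) = l" "set (replicate l j) \<subseteq> {..<n}"
      using \<open>j < n\<close> by auto
    ultimately show ?thesis
      unfolding coord_lary_def by (intro exI[of _ "replicate l j"] exI[of _ hd]) blast
  qed
  moreover have "is_instruction A n ?f"
    unfolding is_instruction_def using ctrl_permutes[OF \<sigma> i] i by (auto simp: nth_ctrl)
  ultimately show ?thesis
    unfolding G_def lary_instruction_def by (intro gen_perm_group.gen_incl) simp
qed

section \<open>Three-cycles from controlled instructions\<close>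

text \<open>Changing coordinate \<open>i\<close> affects neither control condition. Where both hold,
  the commutator of the two alphabet permutations acts; where one fails, its two factors are trivial
  and the other two cancel.\<close>

lemma ctrl_commutator:
  assumes perm: "\<sigma> permutes A" "\<tau> permutes A" and i: "i < n" "i \<notin> J" "i \<notin> K"
  shows "ctrl A n i \<tau> K y \<circ> ctrl A n i \<sigma> J y \<circ> inv (ctrl A n i \<tau> K y) \<circ> inv (ctrl A n i \<sigma> J y)
    = ctrl A n i (\<tau> \<circ> \<sigma> \<circ> inv \<tau> \<circ> inv \<sigma>) (K \<union> J) y" (is "?lhs = ?rhs")
proof
  fix x
  have inv_eq: "\<sigma> (inv \<sigma> a) = a" "\<tau> (inv \<tau> a) = a" for a
    using perm by (simp_all add: permutes_inverses)
  have mem: "inv \<sigma> a \<in> A \<longleftrightarrow> a \<in> A" "inv \<tau> a \<in> A \<longleftrightarrow> a \<in> A" "\<sigma> a \<in> A \<longleftrightarrow> a \<in> A" "\<tau> a \<in> A \<longleftrightarrow> a \<in> A" for a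
    using perm by (simp_all add: permutes_in_image permutes_inv)
  show "?lhs x = ?rhs x"
  proof (cases "x \<in> cube A n")
    case False
    then show ?thesis
      using assms by (simp add: inv_ctrl ctrl_outside)
  next
    case True
    have upd: "ctrl A n i \<rho> L y (x[i := a]) = x[i := if \<forall>j\<in>L. x ! j = y j then \<rho> a else a]"
      if "i \<notin> L" "a \<in> A" for \<rho> L a
      using that True i by (simp add: ctrl_def list_update_cube ball_nth_list_update length_cube)
    have "x ! i \<in> A"
      using True i by (simp add: nth_cube)
    \<comment> \<open>Writing \<open>x\<close> as an update of itself lets \<open>upd\<close>
      evaluate all four factors as updates of one coordinate.\<close>
    then have "?lhs (x[i := x ! i]) = ?rhs (x[i := x ! i])"
      using i by (simp add: inv_ctrl perm upd mem inv_eq ball_Un del: list_update_id)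
    then show ?thesis
      by simp
  qed
qed

text \<open>Conjugation by \<open>transpose a b\<close> inverts the cycle, so the commutator is the
  square of the inverse, which is the cycle again. Commutators can thus be iterated without losing
  the permutation.\<close>

lemma three_cycle_eq_commutator:
  assumes "distinct [a, b, c]"
  shows "transpose a b \<circ> three_cycle a b c \<circ> inv (transpose a b) \<circ> inv (three_cycle a b c)
    = three_cycle a b c"
proof -
  have "transpose a b c = c"
    using assms by (auto simp: transpose_def)
  then have "transpose a b \<circ> three_cycle a b c \<circ> inv (transpose a b) = three_cycle b a c"
    using three_cycle_conj[of "transpose a b" a b c] by simp
  moreover have "three_cycle b a c \<circ> three_cycle c b a = three_cycle a b c"
    using assms by (auto simp: fun_eq_iff three_cycle_apply)
  ultimately show ?thesis
    by (simp only: inv_three_cycle)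
qed

lemma three_cycle_permutes:
  "a \<in> A \<Longrightarrow> b \<in> A \<Longrightarrow> c \<in> A \<Longrightarrow> three_cycle a b c permutes A"
  unfolding three_cycle_def by (intro permutes_compose permutes_swap_id)

text \<open>The commutator with a transposition controlled by \<open>j\<close> alone, a binary
  instruction, adds \<open>j\<close> to the controls and reproduces the three-cycle.\<close>

lemma ctrl_three_cycle_mem_G2:
  assumes "finite A" and abc: "distinct [a, b, c]" "a \<in> A" "b \<in> A" "c \<in> A"
    and "i < n" and J: "J \<subseteq> {..<n}" "i \<notin> J"
  shows "ctrl A n i (three_cycle a b c) J y \<in> G A n 2"
proof -
  interpret perm_group "cube A n" "G A n 2"
    using \<open>finite A\<close> by (rule perm_group_G)
  have "finite J"
    using J(1) finite_subset by blast
  then show ?thesis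
    using J
  proof (induction J)
    case empty
    then show ?case
      using assms by (intro ctrl_mem_G three_cycle_permutes) auto
  next
    case (insert j J)
    let ?t = "ctrl A n i (transpose a b) {j} y" and ?s = "ctrl A n i (three_cycle a b c) J y"
    have "?t \<in> G A n 2"
      using insert.prems assms by (intro ctrl_mem_G permutes_swap_id) auto
    moreover have "?s \<in> G A n 2"
      using insert by simp
    ultimately have "?t \<circ> ?s \<circ> inv ?t \<circ> inv ?s \<in> G A n 2"
      by (simp add: comp_mem inv_mem)
    moreover have "?t \<circ> ?s \<circ> inv ?t \<circ> inv ?s = ctrl A n i (three_cycle a b c) ({j} \<union> J) y"
      using insert.prems assms three_cycle_eq_commutator[OF abc(1)]
      by (subst ctrl_commutator) (auto intro: three_cycle_permutes permutes_swap_id)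
    ultimately show ?case
      by simp
  qed
qed

lemma ctrl_three_cycle_line:
  assumes abc: "distinct [a, b, c]" "a \<in> A" "b \<in> A" "c \<in> A" and i: "i < n" and x: "x \<in> cube A n"
  shows "ctrl A n i (three_cycle a b c) ({..<n} - {i}) ((!) x)
    = three_cycle (x[i := a]) (x[i := b]) (x[i := c])"
    and "distinct [x[i := a], x[i := b], x[i := c]]"
proof -
  have eq_iff: "x[i := d] = x[i := e] \<longleftrightarrow> d = e" for d e
    using i x by (metis length_cube nth_list_update_eq)
  show dist: "distinct [x[i := a], x[i := b], x[i := c]]"
    using abc by (simp add: eq_iff)
  show "ctrl A n i (three_cycle a b c) ({..<n} - {i}) ((!) x)
    = three_cycle (x[i := a]) (x[i := b]) (x[i := c])"
  proof
    fix u
    show "ctrl A n i (three_cycle a b c) ({..<n} - {i}) ((!) x) u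
      = three_cycle (x[i := a]) (x[i := b]) (x[i := c]) u"
    proof (cases "u \<in> cube A n \<and> (\<forall>j\<in>{..<n} - {i}. u ! j = x ! j)")
      case True
      then have u: "u = x[i := u ! i]"
        using x i by (intro cube_eqI[of _ A n] list_update_cube)
          (auto simp: nth_cube length_cube nth_list_update)
      have "u[i := d] = x[i := d]" for d
        by (metis list_update_overwrite u)
      then have "ctrl A n i (three_cycle a b c) ({..<n} - {i}) ((!) x) u = x[i := three_cycle a b c (u ! i)]"
        using True by (simp add: ctrl_def)
      moreover have "three_cycle (x[i := a]) (x[i := b]) (x[i := c]) u = x[i := three_cycle a b c (u ! i)]"
        by (subst u, subst three_cycle_apply[OF dist]) (simp add: three_cycle_apply[OF abc(1)] eq_iff)
      ultimately show ?thesis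
        by simp
    next
      case False
      have "u \<noteq> x[i := d]" if "d \<in> A" for d
        using False that x by (auto simp: list_update_cube) (metis nth_list_update_neq)
      then have "three_cycle (x[i := a]) (x[i := b]) (x[i := c]) u = u"
        using abc by (simp add: three_cycle_apply[OF dist])
      then show ?thesis
        using False by (auto simp: ctrl_def)
    qed
  qed
qed

lemma G2_linked:
  assumes "finite A" "card A \<ge> 3" and xy: "x \<in> cube A n" "y \<in> cube A n"
  shows "perm_group.linked (G A n 2) x y"
proof -
  interpret perm_group "cube A n" "G A n 2"
    using \<open>finite A\<close> by (rule perm_group_G)
  have "linked x (x[i := a])" if x: "x \<in> cube A n" and "i < n" "a \<in> A" for x i a
  proof (cases "a = x ! i")
    case True
    then show ?thesis by (simp add: linked_def)
  next
    case False
    \<comment> \<open>A third letter provides the third point on the line through \<open>x\<close>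
      and \<open>x[i := a]\<close>.\<close>
    have "card {x ! i, a} < card A"
      using False assms by simp
    then obtain c where c: "c \<in> A" "c \<notin> {x ! i, a}"
      by (metis card_mono finite.emptyI finite.insertI linorder_not_less subsetI)
    have abc: "distinct [x ! i, a, c]" "x ! i \<in> A" "a \<in> A" "c \<in> A"
      using c False that by (auto simp: nth_cube)
    have "ctrl A n i (three_cycle (x ! i) a c) ({..<n} - {i}) ((!) x) \<in> G A n 2"
      using assms abc that by (intro ctrl_three_cycle_mem_G2) auto
    then show ?thesis
      using ctrl_three_cycle_line[OF abc \<open>i < n\<close> x] by (auto simp: linked_def)
  qed
  note step = this
  show ?thesis
    by (rule cube_connected[where R = linked, OF _ _ step xy]) (blast intro: linked_refl linked_trans)+
qed

text \<open>Coordinate \<open>k\<close> is toggled twice or not at all, so it ends unchanged. If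
  \<open>J\<close> matches, \<open>k\<close> differs between the two tests made by \<open>u\<close>,
  so exactly one of them succeeds when \<open>j\<close> matches; if \<open>J\<close> does not match,
  both tests agree and the toggles of \<open>i\<close> cancel. All factors are involutions, so this
  is a commutator.\<close>

lemma toggle_commutator:
  fixes a0 a1 :: 'a
  defines "A \<equiv> {a0, a1}" and "\<tau> \<equiv> transpose a0 a1"
  assumes "a0 \<noteq> a1" and ik: "i < n" "k < n" "i \<noteq> k" "i \<notin> J" "k \<notin> J" "j \<noteq> i" "j \<noteq> k" and yk: "y k \<in> A"
  defines "u \<equiv> ctrl A n i \<tau> {j, k} y" and "w \<equiv> ctrl A n k \<tau> J y"
  shows "u \<circ> w \<circ> u \<circ> w = ctrl A n i \<tau> (insert j J) y"
proof
  fix x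
  show "(u \<circ> w \<circ> u \<circ> w) x = ctrl A n i \<tau> (insert j J) y x"
  proof (cases "x \<in> cube A n")
    case False
    then show ?thesis
      by (simp add: u_def w_def ctrl_outside)
  next
    case True
    have \<tau>: "\<tau> permutes A"
      by (simp add: A_def \<tau>_def permutes_swap_id)
    define x1 where "x1 = w x"
    define x2 where "x2 = u x1"
    define x3 where "x3 = w x2"
    have cube: "x1 \<in> cube A n" "x2 \<in> cube A n" "x3 \<in> cube A n" "u x3 \<in> cube A n"
      using True ik \<tau> by (simp_all add: x1_def x2_def x3_def u_def w_def ctrl_cube)
    define m where "m \<longleftrightarrow> (\<forall>j\<in>J. x ! j = y j)"
    have n1: "x1 ! p = (if p = k \<and> m then \<tau> (x ! k) else x ! p)" for p
      using True ik by (simp add: x1_def w_def nth_ctrl m_def)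
    have n2: "x2 ! p = (if p = i \<and> x1 ! j = y j \<and> x1 ! k = y k then \<tau> (x1 ! i) else x1 ! p)" for p
      using cube ik by (simp add: x2_def u_def nth_ctrl)
    have m2: "(\<forall>j\<in>J. x2 ! j = y j) \<longleftrightarrow> m"
    proof -
      have "x2 ! p = x ! p" if "p \<in> J" for p
      proof -
        have "p \<noteq> i" "p \<noteq> k"
          using that ik by auto
        then show ?thesis
          by (simp add: n2 n1)
      qed
      then show ?thesis
        by (simp add: m_def)
    qed
    have n3: "x3 ! p = (if p = k \<and> m then \<tau> (x2 ! k) else x2 ! p)" for p
      using cube ik by (simp add: x3_def w_def nth_ctrl m2)
    have n4: "u x3 ! p = (if p = i \<and> x3 ! j = y j \<and> x3 ! k = y k then \<tau> (x3 ! i) else x3 ! p)" for p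
      using cube ik by (simp add: u_def nth_ctrl)
    have "x ! k = a0 \<or> x ! k = a1" "y k = a0 \<or> y k = a1"
      using nth_cube[OF True ik(2)] yk by (auto simp: A_def)
    then have k: "\<tau> (x ! k) = y k \<longleftrightarrow> x ! k \<noteq> y k" "\<tau> (y k) \<noteq> y k"
      using \<open>a0 \<noteq> a1\<close> by (auto simp: \<tau>_def transpose_def)
    have \<tau>\<tau>: "\<tau> (\<tau> a) = a" for a
      by (simp add: \<tau>_def)
    have "u x3 = ctrl A n i \<tau> (insert j J) y x"
    proof (rule cube_eqI[OF cube(4)])
      show "ctrl A n i \<tau> (insert j J) y x \<in> cube A n"
        using True ik \<tau> by (simp add: ctrl_cube)
      have ctrl_p: "ctrl A n i \<tau> (insert j J) y x ! p
          = (if p = i \<and> x ! j = y j \<and> m then \<tau> (x ! i) else x ! p)" for p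
        using True ik by (simp add: nth_ctrl m_def)
      show "u x3 ! p = ctrl A n i \<tau> (insert j J) y x ! p" for p
        unfolding ctrl_p n4 n3 n2 n1 using ik k by (simp add: \<tau>\<tau>)
    qed
    then show ?thesis
      by (simp add: x3_def x2_def x1_def)
  qed
qed

lemma ctrl_toggle_mem_G3:
  assumes "a0 \<noteq> a1" and J: "J \<subseteq> {..<n}"
    and ik: "i < n" "k < n" "i \<noteq> k" "i \<notin> J" "k \<notin> J" and y: "\<And>j. j < n \<Longrightarrow> y j \<in> {a0, a1}"
  shows "ctrl {a0, a1} n i (transpose a0 a1) J y \<in> G {a0, a1} n 3"
proof -
  interpret perm_group "cube {a0, a1} n" "G {a0, a1} n 3"
    by (rule perm_group_G) simp
  have \<tau>: "transpose a0 a1 permutes {a0, a1}"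
    by (simp add: permutes_swap_id)
  have "finite J"
    using J finite_subset by blast
  then show ?thesis
    using J ik
  proof (induction J arbitrary: i k)
    case empty
    then show ?case
      using \<tau> by (intro ctrl_mem_G) auto
  next
    case (insert j J)
    let ?u = "ctrl {a0, a1} n i (transpose a0 a1) {j, k} y"
      and ?w = "ctrl {a0, a1} n k (transpose a0 a1) J y"
    have "card {j, k} < 3"
      using insert.prems by simp
    then have "?u \<in> G {a0, a1} n 3"
      using insert.prems \<tau> by (intro ctrl_mem_G) auto
    moreover have "?w \<in> G {a0, a1} n 3"
      using insert.prems insert.IH[of k i] by simp
    ultimately have "?u \<circ> ?w \<circ> ?u \<circ> ?w \<in> G {a0, a1} n 3"
      by (simp add: comp_mem)
    moreover have "?u \<circ> ?w \<circ> ?u \<circ> ?w = ctrl {a0, a1} n i (transpose a0 a1) (insert j J) y"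
      using insert.prems assms(1) y[of k] by (intro toggle_commutator) auto
    ultimately show ?case
      by simp
  qed
qed

text \<open>Two toggles of coordinates \<open>i\<close> and \<open>k\<close> move exactly the points
  agreeing with \<open>x\<close> off {i, j} and off {k, m} respectively. For n >= 4 these pairs can
  be chosen disjoint, so \<open>x\<close> is the only common moved point, and the commutator links
  \<open>x\<close> with \<open>x[i := a]\<close>.\<close>

lemma G3_linked:
  assumes "a0 \<noteq> a1" "n \<ge> 4" and xy: "x \<in> cube {a0, a1} n" "y \<in> cube {a0, a1} n"
  shows "perm_group.linked (G {a0, a1} n 3) x y"
proof -
  let ?A = "{a0, a1}" and ?\<tau> = "transpose a0 a1"
  interpret perm_group "cube ?A n" "G ?A n 3"
    by (rule perm_group_G) simp
  have "linked x (x[i := a])" if x: "x \<in> cube ?A n" and "i < n" "a \<in> ?A" for x i a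
  proof (cases "a = x ! i")
    case True
    then show ?thesis by (simp add: linked_def)
  next
    case False
    have \<tau>: "?\<tau> (x ! i) = a"
      using nth_cube[OF x \<open>i < n\<close>] False \<open>a \<in> ?A\<close> by (auto simp: transpose_def)
    have "card ({..<n} - {i}) \<ge> 3"
      using assms \<open>i < n\<close> by simp
    then obtain S where "S \<subseteq> {..<n} - {i}" "card S = 3"
      by (meson obtain_subset_with_card_n)
    then obtain j k m where jkm: "j < n" "k < n" "m < n" "distinct [i, j, k, m]"
      by (auto simp: card_3_iff)
    let ?f = "ctrl ?A n i ?\<tau> ({..<n} - {i, j}) ((!) x)"
      and ?g = "ctrl ?A n k ?\<tau> ({..<n} - {k, m}) ((!) x)"
    have f: "?f \<in> G ?A n 3"
      using jkm \<open>i < n\<close> nth_cube[OF x] assms(1) by (intro ctrl_toggle_mem_G3[of _ _ _ _ _ j]) auto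
    have g: "?g \<in> G ?A n 3"
      using jkm nth_cube[OF x] assms(1) by (intro ctrl_toggle_mem_G3[of _ _ _ _ _ m]) auto
    have moved: "ctrl ?A n p ?\<tau> J ((!) x) z \<noteq> z \<longleftrightarrow> z \<in> cube ?A n \<and> (\<forall>j\<in>J. z ! j = x ! j)"
      if "p < n" for p J z
    proof (cases "z \<in> cube ?A n")
      case True
      have "?\<tau> (z ! p) \<noteq> z ! p"
        using nth_cube[OF True \<open>p < n\<close>] assms(1) by (auto simp: transpose_def)
      then have "z[p := ?\<tau> (z ! p)] \<noteq> z"
        using True \<open>p < n\<close> by (metis length_cube nth_list_update_eq)
      then show ?thesis
        by (auto simp: ctrl_def)
    qed (simp add: ctrl_def)
    have "?f z \<noteq> z \<and> ?g z \<noteq> z \<longleftrightarrow> z = x" for z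
    proof
      assume z: "?f z \<noteq> z \<and> ?g z \<noteq> z"
      show "z = x"
        using z x jkm by (intro cube_eqI[of z ?A n x]) (auto simp: moved \<open>i < n\<close>)
    qed (use x jkm in \<open>simp add: moved \<open>i < n\<close>\<close>)
    note three = commutator_single_common_moved_point[OF bij[OF f] bij[OF g] this]
    have "?f \<circ> ?g \<circ> inv ?f \<circ> inv ?g \<in> G ?A n 3"
      using f g by (simp add: comp_mem inv_mem)
    moreover have "?f x = x[i := a]"
      using x \<tau> by (simp add: ctrl_def)
    ultimately show ?thesis
      using three unfolding linked_def by metis
  qed
  note step = this
  show ?thesis
    by (rule cube_connected[where R = linked, OF _ _ step xy]) (blast intro: linked_refl linked_trans)+
qed

section \<open>Parity of instructions\<close>

lemma exists_permutation_swapping_halves: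
  assumes "finite A" "even (card A)"
  obtains B \<tau> where "\<tau> permutes A" "\<And>a. a \<in> A \<Longrightarrow> \<tau> a \<in> B \<longleftrightarrow> a \<notin> B"
proof -
  obtain B where B: "B \<subseteq> A" "card B = card A div 2"
    by (meson obtain_subset_with_card_n div_le_dividend)
  have "finite B" "card (A - B) = card B"
    using assms B by (auto simp: card_Diff_subset finite_subset)
  then obtain \<sigma> where \<sigma>: "bij_betw \<sigma> B (A - B)"
    using assms(1) finite_same_card_bij by (metis finite_Diff)
  define \<tau> where "\<tau> a = (if a \<in> B then \<sigma> a else if a \<in> A then inv_into B \<sigma> a else a)" for a
  have B1: "bij_betw \<tau> B (A - B)"
    using \<sigma> by (rule bij_betw_cong[THEN iffD1, rotated]) (simp add: \<tau>_def)
  have B2: "bij_betw \<tau> (A - B) B"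
    using bij_betw_inv_into[OF \<sigma>] by (rule bij_betw_cong[THEN iffD1, rotated]) (simp add: \<tau>_def)
  have "bij_betw \<tau> (B \<union> (A - B)) ((A - B) \<union> B)"
    using B1 B2 by (rule bij_betw_combine) blast
  moreover have "B \<union> (A - B) = A" "(A - B) \<union> B = A"
    using B by auto
  ultimately have "\<tau> permutes A"
    using B by (intro bij_imp_permutes) (auto simp: \<tau>_def)
  moreover have "\<tau> a \<in> B \<longleftrightarrow> a \<notin> B" if "a \<in> A" for a
    using that B1 B2 by (auto dest: bij_betwE)
  ultimately show ?thesis
    using that by blast
qed

text \<open>Let \<open>g\<close> be the restriction of \<open>f\<close> to the points whose \<open>k\<close>-th coordinate lies in one half of
  the alphabet, and let \<open>\<psi>\<close> exchange the two halves. If \<open>f\<close> ignores the coordinate \<open>k\<close>, then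
  \<open>f \<circ> \<psi> = g \<circ> \<psi> \<circ> g\<close>, so \<open>f\<close> is even.\<close>

lemma evenperm_if_independent_of_coord:
  assumes A: "finite A" "even (card A)" and f: "f permutes cube A n"
    and k: "k < n" "\<And>x. x \<in> cube A n \<Longrightarrow> f x ! k = x ! k"
    and indep: "\<And>x a j. x \<in> cube A n \<Longrightarrow> a \<in> A \<Longrightarrow> j < n \<Longrightarrow> j \<noteq> k \<Longrightarrow> f (x[k := a]) ! j = f x ! j"
  shows "evenperm f"
proof -
  obtain B \<tau> where \<tau>: "\<tau> permutes A" and B: "\<And>a. a \<in> A \<Longrightarrow> \<tau> a \<in> B \<longleftrightarrow> a \<notin> B"
    using exists_permutation_swapping_halves[OF A] by blast
  define \<psi> where "\<psi> = ctrl A n k \<tau> {} (\<lambda>_. undefined)"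
  define g where "g x = (if x \<in> cube A n \<and> x ! k \<in> B then f x else x)" for x
  have \<psi>: "\<psi> permutes cube A n"
    unfolding \<psi>_def using \<tau> k by (simp add: ctrl_permutes)
  have f_cube: "f x \<in> cube A n \<longleftrightarrow> x \<in> cube A n" for x
    using f by (simp add: permutes_in_image)
  have \<psi>_cube: "\<psi> x \<in> cube A n \<longleftrightarrow> x \<in> cube A n" for x
    using \<psi> by (simp add: permutes_in_image)
  have \<psi>_k: "\<psi> x ! k \<in> B \<longleftrightarrow> x ! k \<notin> B" if "x \<in> cube A n" for x
    using that k B by (simp add: \<psi>_def nth_ctrl nth_cube)
  have \<psi>_eq: "\<psi> x = x[k := \<tau> (x ! k)]" if "x \<in> cube A n" for x
    using that by (simp add: \<psi>_def ctrl_def)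
  have g: "g permutes cube A n"
  proof (rule inj_imp_permutes)
    \<comment> \<open>Since \<open>f\<close> keeps coordinate \<open>k\<close>, the map
      \<open>g\<close> preserves each half of the cube, and the halves cannot collide.\<close>
    show "inj_on g (cube A n)"
    proof (rule inj_onI)
      fix x y
      assume "x \<in> cube A n" "y \<in> cube A n" "g x = g y"
      then have "x ! k = y ! k"
        using k(2)[of x] k(2)[of y] by (auto simp: g_def split: if_splits)
      with \<open>g x = g y\<close> \<open>x \<in> cube A n\<close> \<open>y \<in> cube A n\<close> show "x = y"
        using permutes_inj[OF f] by (auto simp: g_def inj_eq split: if_splits)
    qed
  qed (use A f_cube in \<open>auto simp: g_def finite_cube\<close>)
  have commute: "f (\<psi> x) = \<psi> (f x)" if x: "x \<in> cube A n" for x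
  proof (rule cube_eqI[of _ A n])
    show "f (\<psi> x) \<in> cube A n" "\<psi> (f x) \<in> cube A n"
      using x f_cube \<psi>_cube by auto
    show "f (\<psi> x) ! j = \<psi> (f x) ! j" if "j < n" for j
    proof (cases "j = k")
      case True
      then show ?thesis
        using x k by (simp add: k(2) \<psi>_cube) (simp add: \<psi>_eq f_cube k(2) length_cube[of _ A n])
    next
      case False
      have "\<tau> (x ! k) \<in> A"
        using \<tau> x k by (simp add: permutes_in_image nth_cube)
      then show ?thesis
        using False x that indep by (simp add: \<psi>_eq f_cube)
    qed
  qed
  \<comment> \<open>On the half given by \<open>B\<close> only the first \<open>g\<close> acts, and
    \<open>f\<close> commutes with \<psi>; on the other half \<psi> carries the point into
    \<open>B\<close>, and only the second \<open>g\<close> acts.\<close>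
  have "f \<circ> \<psi> = g \<circ> (\<psi> \<circ> g)"
  proof
    fix x
    show "(f \<circ> \<psi>) x = (g \<circ> (\<psi> \<circ> g)) x"
    proof (cases "x \<in> cube A n")
      case True
      then show ?thesis
        using commute \<psi>_k \<psi>_k[of "f x"] k(2) by (simp add: g_def f_cube \<psi>_cube)
    next
      case False
      then show ?thesis
        using f \<psi> by (simp add: g_def permutes_not_in)
    qed
  qed
  \<comment> \<open>The two factors \<open>g\<close> have the same sign, so
    \<open>f \<circ> \<psi>\<close> has the parity of \<psi>.\<close>
  then have "evenperm (f \<circ> \<psi>) = evenperm (g \<circ> (\<psi> \<circ> g))"
    by simp
  moreover have "permutation f" "permutation \<psi>" "permutation g"
    using f \<psi> g A by (auto intro: permutes_imp_permutation finite_cube)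
  ultimately show ?thesis
    by (auto simp: evenperm_comp permutation_compose)
qed

text \<open>With \<open>n - 1\<close> variables some coordinate \<open>k\<close> is not read. It is
  not the modified one, for otherwise two points differing only there would have the same image;
  hence \<open>f\<close> keeps \<open>k\<close> and ignores it.\<close>

lemma evenperm_if_lary_instruction:
  assumes A: "finite A" "even (card A)" "card A \<ge> 2" and "0 < n"
    and f: "lary_instruction A n (n - 1) f"
  shows "evenperm f"
proof -
  obtain i where i: "i < n" "\<And>x j. x \<in> cube A n \<Longrightarrow> j < n \<Longrightarrow> j \<noteq> i \<Longrightarrow> f x ! j = x ! j"
    and perm: "f permutes cube A n"
    using f by (auto simp: lary_instruction_def is_instruction_def)
  obtain ks h where ks: "length ks = n - 1" "set ks \<subseteq> {..<n}"
    and h: "\<And>x. x \<in> cube A n \<Longrightarrow> f x ! i = h (map ((!) x) ks)"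
    using f i by (auto simp: lary_instruction_def coord_lary_def)
  have "card (set ks) < card {..<n}"
    using card_length[of ks] ks \<open>0 < n\<close> by simp
  then obtain k where k: "k < n" "k \<notin> set ks"
    by (metis card_mono finite_set lessThan_iff linorder_not_less subsetI)
  have indep: "f (x[k := a]) ! i = f x ! i" if "x \<in> cube A n" "a \<in> A" for x a
  proof -
    have "map ((!) (x[k := a])) ks = map ((!) x) ks"
      using k by (auto intro: nth_list_update_neq)
    then show ?thesis
      using that h[of x] h[of "x[k := a]"] by (metis list_update_cube)
  qed
  have "k \<noteq> i"
  proof
    assume "k = i"
    obtain a b where ab: "a \<in> A" "b \<in> A" "a \<noteq> b"
      using A by (metis card_le_Suc0_iff_eq not_less_eq_eq numeral_2_eq_2)
    define x where "x = replicate n a"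
    have x: "x \<in> cube A n"
      using ab by (auto simp: x_def cube_def)
    then have x': "x[i := b] \<in> cube A n"
      using ab by (simp add: list_update_cube)
    have "f (x[i := b]) = f x"
    proof (rule cube_eqI[of _ A n])
      show "f (x[i := b]) ! j = f x ! j" if "j < n" for j
        using that x x' i indep[OF x ab(2)] \<open>k = i\<close> by (cases "j = i") auto
    qed (use x x' perm in \<open>auto simp: permutes_in_image\<close>)
    then have "x[i := b] = x"
      using permutes_inj[OF perm] by (simp add: inj_eq)
    then have "x[i := b] ! i = x ! i"
      by simp
    then show False
      using ab i by (simp add: x_def)
  qed
  show ?thesis
  proof (rule evenperm_if_independent_of_coord[OF A(1,2) perm k(1)])
    show "f x ! k = x ! k" if "x \<in> cube A n" for x
      using that i k \<open>k \<noteq> i\<close> by simp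
    show "f (x[k := a]) ! j = f x ! j" if "x \<in> cube A n" "a \<in> A" "j < n" "j \<noteq> k" for x a j
      using that i indep by (cases "j = i") (simp_all add: list_update_cube)
  qed
qed

section \<open>The alternating upper bound for even alphabets and an odd instruction for odd
  ones\<close>

lemma perm_group_AltC:
  assumes "finite A"
  shows "perm_group (cube A n) (AltC A n)"
proof -
  have perm: "permutation f" if "f permutes cube A n" for f
    using that assms by (auto intro: permutes_imp_permutation finite_cube)
  show ?thesis
  proof
    show "f \<circ> g \<in> AltC A n" if "f \<in> AltC A n" "g \<in> AltC A n" for f g
      using that unfolding AltC_def by (simp only: mem_Collect_eq perm evenperm_comp permutes_compose)
    show "inv f \<in> AltC A n" if "f \<in> AltC A n" for f
      using that unfolding AltC_def by (simp only: mem_Collect_eq perm evenperm_inv permutes_inv)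
  qed (simp_all add: AltC_def assms finite_cube)
qed

lemma G_subset_AltC:
  assumes "finite A" "even (card A)" "card A \<ge> 2" "0 < n"
  shows "G A n (n - 1) \<subseteq> AltC A n"
  unfolding G_def using evenperm_if_lary_instruction[OF assms]
  by (intro gen_perm_group_subset[OF perm_group_AltC[OF assms(1)]])
    (auto simp: AltC_def lary_instruction_def is_instruction_def)

text \<open>The map is a product of one transposition for each tail in \<open>Y\<close>; the
  induction splits off one of them.\<close>

lemma evenperm_transpose_hd:
  fixes a b :: 'a
  defines "F \<equiv> \<lambda>Y u. case u of [] \<Rightarrow> [] | c # v \<Rightarrow> if v \<in> Y then transpose a b c # v else u"
  assumes "finite Y" "a \<noteq> b"
  shows "permutation (F Y) \<and> (evenperm (F Y) \<longleftrightarrow> even (card Y))"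
  using assms(2)
proof (induction Y)
  case empty
  have "F {} = id"
    by (auto simp: F_def fun_eq_iff split: list.split)
  then show ?case
    by simp
next
  case (insert v Y)
  let ?t = "transpose (a # v) (b # v)"
  have "F (insert v Y) = ?t \<circ> F Y"
    using insert.hyps by (auto simp: F_def fun_eq_iff transpose_def split: list.split)
  moreover have "permutation (?t \<circ> F Y)"
    using insert.IH by (intro permutation_compose permutation_swap_id) simp
  moreover have "evenperm (?t \<circ> F Y) \<longleftrightarrow> even (card (insert v Y))"
    using insert \<open>a \<noteq> b\<close> by (simp add: permutation_swap_id evenperm_comp evenperm_swap)
  ultimately show ?case
    by metis
qed

text \<open>Transposing two letters in the first coordinate amounts to
  \<open>card A ^ (n - 1)\<close> disjoint transpositions of points, an odd number. The instruction
  is unary, so it is available at every positive arity.\<close>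

lemma odd_mem_G:
  assumes A: "finite A" "odd (card A)" "card A \<ge> 2" and "0 < n" "0 < l"
  obtains g where "g \<in> G A n l" "\<not> evenperm g"
proof -
  obtain a b where ab: "a \<in> A" "b \<in> A" "a \<noteq> b"
    using A by (metis card_le_Suc0_iff_eq not_less_eq_eq numeral_2_eq_2)
  let ?g = "ctrl A n 0 (transpose a b) {} (\<lambda>_. undefined)"
  obtain m where m: "n = Suc m"
    using \<open>0 < n\<close> gr0_implies_Suc by blast
  have "?g \<in> G A n l"
    using ab assms by (intro ctrl_mem_G permutes_swap_id) auto
  moreover have "?g = (\<lambda>u. case u of [] \<Rightarrow> [] | c # v \<Rightarrow> if v \<in> cube A m then transpose a b c # v else u)"
    using ab m by (auto simp: fun_eq_iff ctrl_def cube_def transpose_def split: list.split)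
  moreover have "card (cube A m) = card A ^ m"
    using card_lists_length_eq[OF A(1), of m] by (simp add: cube_def conj_commute)
  ultimately show ?thesis
    using evenperm_transpose_hd[of "cube A m" a b] A ab that finite_cube by (metis even_power)
qed

section \<open>The binary alphabet\<close>

text \<open>On a two-element alphabet \<open>xor3\<close> is \<open>a + b + c\<close> for either identification with \<open>GF(2)\<close>;
  the maps preserving it coordinatewise are exactly the affine ones.\<close>

definition xor3 :: "'a \<Rightarrow> 'a \<Rightarrow> 'a \<Rightarrow> 'a" where
  "xor3 a b c = (if a = b then c else if a = c then b else a)"

definition vxor3 :: "nat \<Rightarrow> 'a list \<Rightarrow> 'a list \<Rightarrow> 'a list \<Rightarrow> 'a list" where
  "vxor3 n x y z = map (\<lambda>i. xor3 (x ! i) (y ! i) (z ! i)) [0..<n]"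

definition xor3_perms :: "'a set \<Rightarrow> nat \<Rightarrow> ('a list \<Rightarrow> 'a list) set" where
  "xor3_perms A n = {f. f permutes cube A n \<and>
     (\<forall>x\<in>cube A n. \<forall>y\<in>cube A n. \<forall>z\<in>cube A n. f (vxor3 n x y z) = vxor3 n (f x) (f y) (f z))}"

lemma xor3_mem: "a \<in> A \<Longrightarrow> b \<in> A \<Longrightarrow> c \<in> A \<Longrightarrow> xor3 a b c \<in> A"
  by (simp add: xor3_def)

lemma nth_vxor3: "i < n \<Longrightarrow> vxor3 n x y z ! i = xor3 (x ! i) (y ! i) (z ! i)"
  by (simp add: vxor3_def)

lemma vxor3_cube:
  "x \<in> cube A n \<Longrightarrow> y \<in> cube A n \<Longrightarrow> z \<in> cube A n \<Longrightarrow> vxor3 n x y z \<in> cube A n"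
  by (rule cubeI) (simp_all add: vxor3_def xor3_mem nth_cube)

lemma perm_group_xor3_perms:
  assumes "finite A"
  shows "perm_group (cube A n) (xor3_perms A n)"
proof
  show "f \<circ> g \<in> xor3_perms A n" if "f \<in> xor3_perms A n" "g \<in> xor3_perms A n" for f g
    using that unfolding xor3_perms_def by (auto simp: permutes_compose permutes_in_image)
  show "inv f \<in> xor3_perms A n" if f: "f \<in> xor3_perms A n" for f
  proof -
    have perm: "f permutes cube A n"
      using f by (simp add: xor3_perms_def)
    have "inv f (vxor3 n x y z) = vxor3 n (inv f x) (inv f y) (inv f z)"
      if "x \<in> cube A n" "y \<in> cube A n" "z \<in> cube A n" for x y z
    proof -
      have "f (vxor3 n (inv f x) (inv f y) (inv f z)) = vxor3 n x y z"
        using f that permutes_in_image[OF permutes_inv[OF perm]]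
        by (simp add: xor3_perms_def permutes_inverses[OF perm])
      then show ?thesis
        using permutes_inv_eq[OF perm] by metis
    qed
    then show ?thesis
      using permutes_inv[OF perm] by (simp add: xor3_perms_def)
  qed
qed (use assms in \<open>auto simp: xor3_perms_def finite_cube\<close>)

section \<open>Binary instructions preserve sums of three points\<close>

locale binary_cube =
  fixes a0 a1 :: 'a and n :: nat
  assumes a0_a1: "a0 \<noteq> a1"
begin

abbreviation "A \<equiv> {a0, a1}"

text \<open>Among three letters of a pair two coincide, and \<open>xor3\<close> returns the
  remaining one; in other words, every function of one bit is affine.\<close>

lemma xor3_preserving_unary:
  assumes "a \<in> A" "a' \<in> A" "a'' \<in> A"
  shows "\<phi> (xor3 a a' a'') = xor3 (\<phi> a) (\<phi> a') (\<phi> a'')"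
  using assms a0_a1 unfolding xor3_def by (elim insertE emptyE) simp_all

text \<open>With \<open>a0\<close> as zero, both sides are the sum of all six letters.\<close>

lemma xor3_xor3:
  assumes "a \<in> A" "a' \<in> A" "a'' \<in> A" "b \<in> A" "b' \<in> A" "b'' \<in> A"
  shows "xor3 (xor3 a a' a'') (xor3 b b' b'') a0 = xor3 (xor3 a b a0) (xor3 a' b' a0) (xor3 a'' b'' a0)"
  using assms by (elim insertE emptyE) (simp_all add: xor3_def a0_a1 a0_a1[symmetric])

text \<open>A map bijective in its first argument is the sum of \<open>a\<close> and
  \<open>\<phi> a0 b\<close>, with \<open>a0\<close> as zero. Both summands depend on one letter
  each and are therefore affine.\<close>

lemma xor3_preserving_if_bijective:
  assumes bij: "\<And>b. b \<in> A \<Longrightarrow> \<phi> a0 b \<noteq> \<phi> a1 b" and mem: "\<And>a b. a \<in> A \<Longrightarrow> b \<in> A \<Longrightarrow> \<phi> a b \<in> A"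
    and a: "a \<in> A" "a' \<in> A" "a'' \<in> A" and b: "b \<in> A" "b' \<in> A" "b'' \<in> A"
  shows "\<phi> (xor3 a a' a'') (xor3 b b' b'') = xor3 (\<phi> a b) (\<phi> a' b') (\<phi> a'' b'')"
proof -
  have \<phi>: "\<phi> a b = xor3 a (\<phi> a0 b) a0" if "a \<in> A" "b \<in> A" for a b
    using bij[OF that(2)] mem[OF _ that(2)] that(1) a0_a1 by (fastforce simp: xor3_def)
  have "xor3 (xor3 a a' a'') (\<phi> a0 (xor3 b b' b'')) a0
      = xor3 (xor3 a (\<phi> a0 b) a0) (xor3 a' (\<phi> a0 b') a0) (xor3 a'' (\<phi> a0 b'') a0)"
    unfolding xor3_preserving_unary[OF b, of "\<phi> a0"] using a b mem by (intro xor3_xor3) auto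
  then show ?thesis
    using \<phi>[OF xor3_mem[OF a] xor3_mem[OF b]] \<phi>[OF a(1) b(1)] \<phi>[OF a(2) b(2)] \<phi>[OF a(3) b(3)]
    by simp
qed

text \<open>Injectivity forces the modified coordinate to depend on itself. It is thus a function of
  \<open>x ! i\<close> and at most one other coordinate, bijective in \<open>x ! i\<close>.\<close>

lemma binary_instruction_preserves_xor3:
  assumes "lary_instruction A n 2 f"
  shows "f \<in> xor3_perms A n"
proof -
  obtain i where i: "i < n" "\<And>x j. x \<in> cube A n \<Longrightarrow> j < n \<Longrightarrow> j \<noteq> i \<Longrightarrow> f x ! j = x ! j"
    and perm: "f permutes cube A n"
    using assms by (auto simp: lary_instruction_def is_instruction_def)
  obtain ks h where ks: "length ks = 2" "set ks \<subseteq> {..<n}"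
    and h: "\<And>x. x \<in> cube A n \<Longrightarrow> f x ! i = h (map ((!) x) ks)"
    using assms i by (auto simp: lary_instruction_def coord_lary_def)
  obtain k1 k2 where k12: "ks = [k1, k2]"
    using ks(1) by (auto simp: numeral_2_eq_2 length_Suc_conv)
  have f_cube: "f x \<in> cube A n \<longleftrightarrow> x \<in> cube A n" for x
    using perm by (simp add: permutes_in_image)
  have change: "f (x[i := a0]) ! i \<noteq> f (x[i := a1]) ! i" if x: "x \<in> cube A n" for x
  proof
    assume eq: "f (x[i := a0]) ! i = f (x[i := a1]) ! i"
    have cube: "x[i := a0] \<in> cube A n" "x[i := a1] \<in> cube A n"
      using x by (simp_all add: list_update_cube)
    have "f (x[i := a0]) = f (x[i := a1])"
    proof (rule cube_eqI[of _ A n])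
      show "f (x[i := a0]) ! j = f (x[i := a1]) ! j" if "j < n" for j
        using that i cube eq by (cases "j = i") auto
    qed (simp_all add: f_cube cube)
    then have "x[i := a0] = x[i := a1]"
      using permutes_inj[OF perm] by (simp add: inj_eq)
    then show False
      using i a0_a1 length_cube[OF x] by (metis nth_list_update_eq)
  qed
  have "replicate n a0 \<in> cube A n"
    by (auto simp: cube_def)
  have "i \<in> {k1, k2}"
  proof (rule ccontr)
    assume "i \<notin> {k1, k2}"
    then have "f (x[i := a0]) ! i = f (x[i := a1]) ! i" if "x \<in> cube A n" for x
      using that by (simp add: h list_update_cube k12)
    then show False
      using change \<open>replicate n a0 \<in> cube A n\<close> by blast
  qed
  then obtain k \<phi> where k: "k < n" and \<phi>: "\<And>x. x \<in> cube A n \<Longrightarrow> f x ! i = \<phi> (x ! i) (x ! k)"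
  proof
    assume "i = k1"
    then show ?thesis
      using that[of k2 "\<lambda>a b. h [a, b]"] h ks k12 by simp
  next
    assume "i \<in> {k2}"
    then show ?thesis
      using that[of k1 "\<lambda>a b. h [b, a]"] h ks k12 by simp
  qed
  have "f (vxor3 n x y z) = vxor3 n (f x) (f y) (f z)"
    if xyz: "x \<in> cube A n" "y \<in> cube A n" "z \<in> cube A n" for x y z
  proof (rule cube_eqI[of _ A n])
    have v: "vxor3 n x y z \<in> cube A n"
      using xyz by (rule vxor3_cube)
    then show "f (vxor3 n x y z) \<in> cube A n" "vxor3 n (f x) (f y) (f z) \<in> cube A n"
      using xyz by (simp_all add: f_cube vxor3_cube)
    fix j assume "j < n"
    show "f (vxor3 n x y z) ! j = vxor3 n (f x) (f y) (f z) ! j"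
    proof (cases "j = i")
      case False
      then show ?thesis
        using i \<open>j < n\<close> v xyz by (simp add: nth_vxor3)
    next
      case j: True
      note mem = nth_cube[OF xyz(1)] nth_cube[OF xyz(2)] nth_cube[OF xyz(3)]
      show ?thesis
      proof (cases "k = i")
        case True
        then show ?thesis
          using xor3_preserving_unary[of "x ! i" "y ! i" "z ! i" "\<lambda>a. \<phi> a a"] mem i(1) j
          by (simp add: nth_vxor3 \<phi> v xyz)
      next
        case False
        \<comment> \<open>These points realise every pair of letters at positions \<open>i\<close>
          and \<open>k\<close>, which transfers range and injectivity from \<open>f\<close> to
          \<phi>.\<close>
        have pt: "(replicate n a0)[k := b, i := a] \<in> cube A n" if "a \<in> A" "b \<in> A" for a b
          using that \<open>replicate n a0 \<in> cube A n\<close> by (intro list_update_cube)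
        have \<phi>_pt: "f ((replicate n a0)[k := b, i := a]) ! i = \<phi> a b" if "a \<in> A" "b \<in> A" for a b
          using \<phi>[OF pt[OF that]] k i(1) False by simp
        have "\<phi> a b \<in> A" if "a \<in> A" "b \<in> A" for a b
          using \<phi>_pt[OF that] pt[OF that] f_cube nth_cube i(1) by metis
        moreover have "\<phi> a0 b \<noteq> \<phi> a1 b" if "b \<in> A" for b
          using change[of "(replicate n a0)[k := b]"] \<phi>_pt[of a0 b] \<phi>_pt[of a1 b] that
            list_update_cube[OF \<open>replicate n a0 \<in> cube A n\<close> that] by simp
        ultimately show ?thesis
          using xor3_preserving_if_bijective[of \<phi> "x ! i" "y ! i" "z ! i" "x ! k" "y ! k" "z ! k"]
            mem i(1) k j
          by (simp add: nth_vxor3 \<phi> v xyz)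
      qed
    qed
  qed
  then show ?thesis
    using perm by (simp add: xor3_perms_def)
qed

lemma G2_subset_xor3_perms: "G A n 2 \<subseteq> xor3_perms A n"
  unfolding G_def
  by (intro gen_perm_group_subset[OF perm_group_xor3_perms]) (auto intro: binary_instruction_preserves_xor3)

section \<open>Gaussian elimination by binary instructions\<close>

definition Z :: "'a list" where
  "Z = replicate n a0"

text \<open>With \<open>a0\<close> as 0 and \<open>a1\<close> as 1, these are the unit vectors and
  \<open>Z\<close> is the zero vector.\<close>

definition E :: "nat \<Rightarrow> 'a list" where
  "E k = Z[k := a1]"

lemma Z_cube: "Z \<in> cube A n"
  by (auto simp: Z_def cube_def)

lemma E_cube: "E k \<in> cube A n"
  by (simp add: E_def Z_cube list_update_cube)

lemma nth_Z: "i < n \<Longrightarrow> Z ! i = a0"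
  by (simp add: Z_def)

lemma nth_E: "i < n \<Longrightarrow> E k ! i = (if i = k then a1 else a0)"
  by (simp add: E_def Z_def nth_list_update)

lemma vxor3_split:
  assumes "w \<in> cube A n" "k < n" "w ! k = a1"
  shows "w = vxor3 n (w[k := a0]) (E k) Z"
proof (rule cube_eqI[OF assms(1)])
  show "vxor3 n (w[k := a0]) (E k) Z \<in> cube A n"
    using assms by (intro vxor3_cube list_update_cube E_cube Z_cube) auto
  show "w ! i = vxor3 n (w[k := a0]) (E k) Z ! i" if "i < n" for i
    using assms that length_cube[OF assms(1)]
    by (auto simp: nth_vxor3 nth_E nth_Z nth_list_update xor3_def)
qed

text \<open>Words equal to \<open>a0\<close> from position \<open>k\<close> on form the span of the
  first \<open>k\<close> unit vectors; \<open>vxor3_split\<close> removes one unit vector at a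
  time.\<close>

lemma xor3_perms_fix_span:
  assumes f: "f \<in> xor3_perms A n" "f Z = Z" "\<And>j. j < k \<Longrightarrow> f (E j) = E j"
    and "k \<le> n" and w: "w \<in> cube A n" "\<And>j. k \<le> j \<Longrightarrow> j < n \<Longrightarrow> w ! j = a0"
  shows "f w = w"
  using f(3) \<open>k \<le> n\<close> w
proof (induction k arbitrary: w)
  case 0
  then have "w = Z"
    by (intro cube_eqI[of w A n Z]) (simp_all add: Z_cube nth_Z)
  then show ?case
    using f by simp
next
  case (Suc k)
  show ?case
  proof (cases "w ! k = a0")
    case True
    then have "w ! j = a0" if "k \<le> j" "j < n" for j
      using Suc.prems(4)[of j] that by (cases "j = k") auto
    then show ?thesis
      using Suc by simp
  next
    case False
    let ?w = "w[k := a0]"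
    have "w ! k = a1"
      using False nth_cube[OF Suc.prems(3), of k] Suc.prems(2) by auto
    then have split: "w = vxor3 n ?w (E k) Z"
      using Suc.prems by (intro vxor3_split) auto
    have w': "?w \<in> cube A n"
      using Suc.prems(3) by (simp add: list_update_cube)
    have "?w ! j = a0" if "k \<le> j" "j < n" for j
      using Suc.prems(4)[of j] that length_cube[OF Suc.prems(3)] by (cases "j = k") auto
    then have "f ?w = ?w"
      using Suc w' by simp
    moreover have "f (vxor3 n ?w (E k) Z) = vxor3 n (f ?w) (f (E k)) (f Z)"
      using f(1) w' E_cube Z_cube by (simp add: xor3_perms_def)
    ultimately show ?thesis
      using split Suc.prems(1)[of k] f(2) by simp
  qed
qed

interpretation G2: perm_group "cube A n" "G A n 2"
  by (rule perm_group_G) simp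

text \<open>The moves still allowed at stage \<open>k\<close> of the elimination: they keep the
  vectors already put in place.\<close>

definition fixers :: "nat \<Rightarrow> ('a list \<Rightarrow> 'a list) set" where
  "fixers k = {h \<in> G A n 2. h Z = Z \<and> (\<forall>m<k. h (E m) = E m)}"

text \<open>The elementary row operation adding coordinate \<open>j\<close> to coordinate
  \<open>i\<close>.\<close>

definition add_coord :: "nat \<Rightarrow> nat \<Rightarrow> 'a list \<Rightarrow> 'a list" where
  "add_coord i j = ctrl A n i (transpose a0 a1) {j} (\<lambda>_. a1)"

text \<open>Coordinate \<open>j\<close> vanishes in \<open>Z\<close> and in every \<open>E m\<close>
  with \<open>m < k\<close>, so the control does not fire there.\<close>

lemma add_coord_fixers:
  assumes "i < n" "j < n" "i \<noteq> j" "k \<le> j"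
  shows "add_coord i j \<in> fixers k"
proof -
  have "add_coord i j \<in> G A n 2"
    unfolding add_coord_def using assms by (intro ctrl_mem_G permutes_swap_id) auto
  then show ?thesis
    using assms a0_a1 by (auto simp: fixers_def add_coord_def ctrl_def nth_Z nth_E)
qed

lemma nth_add_coord:
  assumes "x \<in> cube A n" "i < n"
  shows "add_coord i j x ! p = (if p = i \<and> x ! j = a1 then transpose a0 a1 (x ! i) else x ! p)"
  using assms by (simp add: add_coord_def nth_ctrl)

lemma comp_fixers: "h \<in> fixers k \<Longrightarrow> h' \<in> fixers k \<Longrightarrow> h \<circ> h' \<in> fixers k"
  by (simp add: fixers_def G2.comp_mem)

lemma id_fixers: "id \<in> fixers k"
  by (simp add: fixers_def G2.id_mem)

lemma fixers_cube: "h \<in> fixers k \<Longrightarrow> x \<in> cube A n \<Longrightarrow> h x \<in> cube A n"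
  using G2.permutes permutes_in_image by (fastforce simp: fixers_def)

text \<open>Coordinate \<open>k\<close> is the pivot and is added to every other nonzero coordinate
  in turn.\<close>

lemma fixers_clear:
  assumes v: "v \<in> cube A n" "v ! k = a1" and "k < n" "m \<le> n"
  shows "\<exists>h\<in>fixers k. h v ! k = a1 \<and> (\<forall>i<m. i \<noteq> k \<longrightarrow> h v ! i = a0)"
  using \<open>m \<le> n\<close>
proof (induction m)
  case 0
  then show ?case
    using v id_fixers by (intro bexI[of _ id]) auto
next
  case (Suc m)
  then obtain h where h: "h \<in> fixers k" "h v ! k = a1" "\<And>i. i < m \<Longrightarrow> i \<noteq> k \<Longrightarrow> h v ! i = a0"
    by auto
  have hv: "h v \<in> cube A n"
    using h v by (simp add: fixers_cube)
  show ?case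
  proof (cases "m = k \<or> h v ! m = a0")
    case True
    then show ?thesis
      using h by (intro bexI[of _ h]) (auto simp: less_Suc_eq)
  next
    case False
    have "h v ! m = a1"
      using False nth_cube[OF hv, of m] Suc.prems by auto
    then have "\<forall>i<Suc m. i \<noteq> k \<longrightarrow> (add_coord m k \<circ> h) v ! i = a0" "(add_coord m k \<circ> h) v ! k = a1"
      using h hv Suc.prems False by (auto simp: nth_add_coord less_Suc_eq)
    moreover have "add_coord m k \<circ> h \<in> fixers k"
      using h Suc.prems False \<open>k < n\<close> by (intro comp_fixers add_coord_fixers) auto
    ultimately show ?thesis
      by blast
  qed
qed

lemma fixers_move_to_unit:
  assumes v: "v \<in> cube A n" and j: "k \<le> j" "j < n" "v ! j = a1"
  shows "\<exists>h\<in>fixers k. h v = E k"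
proof -
  have "k < n"
    using j by simp
  \<comment> \<open>If position \<open>k\<close> holds a zero, the one at position \<open>j\<close>
    is added to it to create the pivot.\<close>
  have "\<exists>h\<in>fixers k. h v ! k = a1"
  proof (cases "v ! k = a1")
    case True
    then show ?thesis
      using id_fixers by (intro bexI[of _ id]) auto
  next
    case False
    then have "v ! k = a0" "j \<noteq> k"
      using nth_cube[OF v \<open>k < n\<close>] j by auto
    then show ?thesis
      using add_coord_fixers[of k j k] j \<open>k < n\<close> v
      by (intro bexI[of _ "add_coord k j"]) (auto simp: nth_add_coord)
  qed
  then obtain h where h: "h \<in> fixers k" "h v ! k = a1"
    by blast
  have hv: "h v \<in> cube A n"
    using h v by (simp add: fixers_cube)
  then obtain h' where h': "h' \<in> fixers k" "h' (h v) ! k = a1" "\<forall>i<n. i \<noteq> k \<longrightarrow> h' (h v) ! i = a0"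
    using fixers_clear[OF hv h(2) \<open>k < n\<close>, of n] by auto
  then have "(h' \<circ> h) v = E k"
    using fixers_cube[OF h'(1) hv] by (intro cube_eqI[of _ A n "E k"]) (auto simp: E_cube nth_E)
  then show ?thesis
    using comp_fixers[OF h'(1) h(1)] by blast
qed

lemma G2_transitive:
  assumes "x \<in> cube A n" "y \<in> cube A n"
  shows "\<exists>h\<in>G A n 2. h x = y"
proof (rule cube_connected[of A n "\<lambda>x y. \<exists>h\<in>G A n 2. h x = y", OF _ _ _ assms])
  show "\<exists>h\<in>G A n 2. h x = x" for x
    using G2.id_mem by (intro bexI[of _ id]) auto
  show "\<exists>h\<in>G A n 2. h x = z" if "\<exists>h\<in>G A n 2. h x = y" "\<exists>h\<in>G A n 2. h y = z" for x y z
    using that G2.comp_mem by (metis comp_apply)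
  show "\<exists>h\<in>G A n 2. h x = x[i := a]" if "x \<in> cube A n" "i < n" "a \<in> A" for x i a
  proof (cases "a = x ! i")
    case True
    then show ?thesis
      using G2.id_mem by (intro bexI[of _ id]) auto
  next
    case False
    let ?h = "ctrl A n i (transpose a0 a1) {} (\<lambda>_. a0)"
    have "transpose a0 a1 (x ! i) = a"
      using False that nth_cube[OF that(1,2)] by auto
    then have "?h x = x[i := a]"
      using that by (simp add: ctrl_def)
    moreover have "?h \<in> G A n 2"
      using that by (intro ctrl_mem_G permutes_swap_id) auto
    ultimately show ?thesis
      by blast
  qed
qed

lemma gaussian_elimination:
  assumes f: "f \<in> xor3_perms A n" and "k \<le> n"
  shows "\<exists>h\<in>G A n 2. h (f Z) = Z \<and> (\<forall>m<k. h (f (E m)) = E m)"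
  using \<open>k \<le> n\<close>
proof (induction k)
  case 0
  have "f Z \<in> cube A n"
    using f Z_cube by (simp add: xor3_perms_def permutes_in_image)
  then show ?case
    using G2_transitive[OF _ Z_cube] by auto
next
  case (Suc k)
  then obtain h where h: "h \<in> G A n 2" "h (f Z) = Z" "\<And>m. m < k \<Longrightarrow> h (f (E m)) = E m"
    by auto
  interpret P: perm_group "cube A n" "xor3_perms A n"
    by (rule perm_group_xor3_perms) simp
  let ?g = "h \<circ> f"
  have g: "?g \<in> xor3_perms A n"
    using h(1) f G2_subset_xor3_perms by (intro P.comp_mem) auto
  have v: "?g (E k) \<in> cube A n"
    using P.permutes[OF g] E_cube permutes_in_image by metis
  \<comment> \<open>Without a pivot, \<open>?g (E k)\<close> lies in the span of the first
    \<open>k\<close> unit vectors, which \<open>?g\<close> fixes pointwise. Injectivity then gives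
    \<open>?g (E k) = E k\<close>, which has a one at position \<open>k\<close>.\<close>
  have "\<exists>j. k \<le> j \<and> j < n \<and> ?g (E k) ! j = a1"
  proof (rule ccontr)
    assume none: "\<nexists>j. k \<le> j \<and> j < n \<and> ?g (E k) ! j = a1"
    have "?g (?g (E k)) = ?g (E k)"
    proof (rule xor3_perms_fix_span[OF g _ _ _ v])
      show "?g (E k) ! j = a0" if "k \<le> j" "j < n" for j
        using none that nth_cube[OF v] by blast
    qed (use h Suc.prems in auto)
    then have "?g (E k) = E k"
      using P.bij[OF g] by (metis bij_is_inj injD)
    then show False
      using none Suc.prems nth_E[of k k] by auto
  qed
  then obtain h' where h': "h' \<in> fixers k" "h' (?g (E k)) = E k"
    using fixers_move_to_unit[OF v] by blast
  have "h' \<circ> h \<in> G A n 2"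
    using h h' G2.comp_mem by (simp add: fixers_def)
  moreover have "(h' \<circ> h) (f Z) = Z" "\<forall>m<Suc k. (h' \<circ> h) (f (E m)) = E m"
    using h h' by (auto simp: fixers_def less_Suc_eq)
  ultimately show ?case
    by blast
qed

text \<open>After complete elimination \<open>h \<circ> f\<close> fixes zero and all unit vectors,
  hence every point, and \<open>f\<close> is the inverse of \<open>h\<close>.\<close>

lemma xor3_perms_subset_G2: "xor3_perms A n \<subseteq> G A n 2"
proof
  fix f assume f: "f \<in> xor3_perms A n"
  obtain h where h: "h \<in> G A n 2" "h (f Z) = Z" "\<And>m. m < n \<Longrightarrow> h (f (E m)) = E m"
    using gaussian_elimination[OF f, of n] by auto
  interpret P: perm_group "cube A n" "xor3_perms A n"
    by (rule perm_group_xor3_perms) simp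
  have g: "h \<circ> f \<in> xor3_perms A n"
    using h(1) f G2_subset_xor3_perms by (intro P.comp_mem) auto
  have "(h \<circ> f) x = x" for x
  proof (cases "x \<in> cube A n")
    case True
    show ?thesis
      by (rule xor3_perms_fix_span[OF g _ _ order_refl True]) (use h in auto)
  next
    case False
    then show ?thesis
      using P.permutes[OF g] permutes_not_in by metis
  qed
  then have id: "h \<circ> f = id"
    by auto
  have "f = (inv h \<circ> h) \<circ> f"
    using G2.bij[OF h(1)] by (simp add: bij_is_inj)
  also have "\<dots> = inv h"
    by (simp only: comp_assoc id comp_id)
  finally show "f \<in> G A n 2"
    using G2.inv_mem h by simp
qed


lemma bit_add_self: "b + b = (0 :: bit)"
  by (cases b) simp_all

lemma enc2_xor3:
  assumes "a \<in> A" "b \<in> A" "c \<in> A"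
  shows "enc2 a1 (xor3 a b c) = enc2 a1 a + enc2 a1 b + enc2 a1 c"
  using assms a0_a1 by (auto simp: xor3_def enc2_def)

lemma enc2_inj: "a \<in> A \<Longrightarrow> b \<in> A \<Longrightarrow> enc2 a1 a = enc2 a1 b \<Longrightarrow> a = b"
  using a0_a1 by (auto simp: enc2_def split: if_splits)

lemma dec2_enc2: "a \<in> A \<Longrightarrow> dec2 a0 a1 (enc2 a1 a) = a"
  by (auto simp: enc2_def dec2_def)

lemma enc2_dec2: "enc2 a1 (dec2 a0 a1 b) = b"
  using a0_a1 by (cases b) (auto simp: enc2_def dec2_def)

text \<open>Sums and products of bits stay in ring form, so that distributivity and the rules for
  finite sums apply.\<close>

declare add_bit_eq_xor [simp del] mult_bit_eq_and [simp del]

definition aff_vec :: "('a list \<Rightarrow> 'a list) \<Rightarrow> nat \<Rightarrow> bit" where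
  "aff_vec f i = enc2 a1 (f Z ! i)"

text \<open>Column \<open>j\<close> is the difference of the images of \<open>E j\<close> and
  \<open>Z\<close>, which is their sum in characteristic two; \<open>aff_vec\<close> is the
  translation part.\<close>

definition aff_mat :: "('a list \<Rightarrow> 'a list) \<Rightarrow> nat \<Rightarrow> nat \<Rightarrow> bit" where
  "aff_mat f i j = enc2 a1 (f (E j) ! i) + aff_vec f i"

lemma enc2_xor3_perms_span:
  assumes f: "f \<in> xor3_perms A n" and "i < n"
    and "k \<le> n" and w: "w \<in> cube A n" "\<And>j. k \<le> j \<Longrightarrow> j < n \<Longrightarrow> w ! j = a0"
  shows "enc2 a1 (f w ! i) = (\<Sum>j<k. aff_mat f i j * enc2 a1 (w ! j)) + aff_vec f i"
  using \<open>k \<le> n\<close> w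
proof (induction k arbitrary: w)
  case 0
  then have "w = Z"
    by (intro cube_eqI[of w A n Z]) (simp_all add: Z_cube nth_Z)
  then show ?case
    by (simp add: aff_vec_def)
next
  case (Suc k)
  show ?case
  proof (cases "w ! k = a0")
    case True
    then have "w ! j = a0" if "k \<le> j" "j < n" for j
      using Suc.prems(3)[of j] that by (cases "j = k") auto
    then show ?thesis
      using Suc True a0_a1 by (simp add: enc2_def)
  next
    case False
    let ?w = "w[k := a0]"
    have wk: "w ! k = a1"
      using False nth_cube[OF Suc.prems(2), of k] Suc.prems(1) by auto
    then have split: "w = vxor3 n ?w (E k) Z"
      using Suc.prems by (intro vxor3_split) auto
    have w': "?w \<in> cube A n"
      using Suc.prems(2) by (simp add: list_update_cube)
    have "?w ! j = a0" if "k \<le> j" "j < n" for j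
      using Suc.prems(3)[of j] that length_cube[OF Suc.prems(2)] by (cases "j = k") auto
    then have IH: "enc2 a1 (f ?w ! i) = (\<Sum>j<k. aff_mat f i j * enc2 a1 (?w ! j)) + aff_vec f i"
      using Suc w' by simp
    have sum: "(\<Sum>j<k. aff_mat f i j * enc2 a1 (?w ! j)) = (\<Sum>j<k. aff_mat f i j * enc2 a1 (w ! j))"
      by (intro sum.cong) auto
    have cube: "f ?w \<in> cube A n" "f (E k) \<in> cube A n" "f Z \<in> cube A n"
      using f w' E_cube Z_cube by (simp_all add: xor3_perms_def permutes_in_image)
    have "f w = vxor3 n (f ?w) (f (E k)) (f Z)"
      using f w' E_cube Z_cube by (subst split) (simp add: xor3_perms_def)
    then have "enc2 a1 (f w ! i) = enc2 a1 (f ?w ! i) + enc2 a1 (f (E k) ! i) + enc2 a1 (f Z ! i)"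
      using \<open>i < n\<close> enc2_xor3[OF nth_cube[OF cube(1)] nth_cube[OF cube(2)] nth_cube[OF cube(3)]]
      by (simp add: nth_vxor3)
    also have "\<dots> = (\<Sum>j<k. aff_mat f i j * enc2 a1 (w ! j)) + aff_vec f i + aff_mat f i k"
      unfolding IH sum by (simp add: aff_mat_def aff_vec_def)
    also have "\<dots> = (\<Sum>j<Suc k. aff_mat f i j * enc2 a1 (w ! j)) + aff_vec f i"
      by (simp add: wk enc2_def)
    finally show ?thesis .
  qed
qed

lemma enc2_xor3_perms:
  assumes "f \<in> xor3_perms A n" "i < n" "w \<in> cube A n"
  shows "enc2 a1 (f w ! i) = (\<Sum>j<n. aff_mat f i j * enc2 a1 (w ! j)) + aff_vec f i"
  using enc2_xor3_perms_span[of f i n w] assms by simp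

text \<open>The inverse matrix is the linear part of the inverse permutation.\<close>

lemma invertible2_aff_mat:
  assumes f: "f \<in> xor3_perms A n"
  shows "invertible2 n (aff_mat f)"
  unfolding invertible2_def
proof (intro exI[of _ "aff_mat (inv f)"] allI impI)
  fix i k assume "i < n" "k < n"
  interpret P: perm_group "cube A n" "xor3_perms A n"
    by (rule perm_group_xor3_perms) simp
  have inv_f: "inv f (f w) = w" for w
    using P.bij[OF f] by (simp add: bij_is_inj)
  have cube: "f (E k) \<in> cube A n" "f Z \<in> cube A n"
    using P.permutes[OF f] E_cube Z_cube by (simp_all add: permutes_in_image)
  let ?N = "aff_mat (inv f)"
  have "(\<Sum>j<n. ?N i j * aff_mat f j k)
      = (\<Sum>j<n. ?N i j * enc2 a1 (f (E k) ! j)) + (\<Sum>j<n. ?N i j * enc2 a1 (f Z ! j))"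
    by (simp add: aff_mat_def[of f] aff_vec_def[of f] distrib_left sum.distrib)
  \<comment> \<open>Adding the translation part twice changes nothing and completes each sum to a
    value of \<open>inv f\<close>.\<close>
  also have "\<dots> = ((\<Sum>j<n. ?N i j * enc2 a1 (f (E k) ! j)) + aff_vec (inv f) i)
      + ((\<Sum>j<n. ?N i j * enc2 a1 (f Z ! j)) + aff_vec (inv f) i)"
    using bit_add_self[of "aff_vec (inv f) i"] by (simp add: algebra_simps)
  also have "\<dots> = enc2 a1 (E k ! i) + enc2 a1 (Z ! i)"
    using enc2_xor3_perms[OF P.inv_mem[OF f] \<open>i < n\<close> cube(1)]
      enc2_xor3_perms[OF P.inv_mem[OF f] \<open>i < n\<close> cube(2)]
    by (simp only: inv_f)
  also have "\<dots> = (if i = k then 1 else 0)"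
    using \<open>i < n\<close> a0_a1 by (simp add: nth_E nth_Z enc2_def)
  finally show "(\<Sum>j<n. ?N i j * aff_mat f j k) = (if i = k then 1 else 0)" .
qed

lemma xor3_perms_subset_AffC: "xor3_perms A n \<subseteq> AffC a0 a1 n"
proof
  fix f assume f: "f \<in> xor3_perms A n"
  then have perm: "f permutes cube A n"
    by (simp add: xor3_perms_def)
  have "f x = map (\<lambda>i. dec2 a0 a1 ((\<Sum>j<n. aff_mat f i j * enc2 a1 (x ! j)) + aff_vec f i)) [0..<n]"
    if x: "x \<in> cube A n" for x
  proof -
    have fx: "f x \<in> cube A n"
      using x perm by (simp add: permutes_in_image)
    then show ?thesis
      using x by (intro nth_equalityI)
        (simp_all add: length_cube[OF fx] dec2_enc2[OF nth_cube[OF fx]] flip: enc2_xor3_perms[OF f])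
  qed
  then show "f \<in> AffC a0 a1 n"
    unfolding AffC_def using perm invertible2_aff_mat[OF f] by blast
qed

text \<open>In a sum of three images the translation part occurs three times, and b + b + b = b over
  GF(2).\<close>

lemma AffC_subset_xor3_perms: "AffC a0 a1 n \<subseteq> xor3_perms A n"
proof
  fix f assume "f \<in> AffC a0 a1 n"
  then obtain M b where perm: "f permutes cube A n"
    and f: "\<And>x. x \<in> cube A n \<Longrightarrow>
      f x = map (\<lambda>i. dec2 a0 a1 ((\<Sum>j<n. M i j * enc2 a1 (x ! j)) + b i)) [0..<n]"
    by (auto simp: AffC_def)
  have f_cube: "f x \<in> cube A n \<longleftrightarrow> x \<in> cube A n" for x
    using perm by (simp add: permutes_in_image)
  have enc_f: "enc2 a1 (f x ! i) = (\<Sum>j<n. M i j * enc2 a1 (x ! j)) + b i"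
    if "x \<in> cube A n" "i < n" for x i
    using that by (simp add: f enc2_dec2)
  have "f (vxor3 n x y z) = vxor3 n (f x) (f y) (f z)"
    if xyz: "x \<in> cube A n" "y \<in> cube A n" "z \<in> cube A n" for x y z
  proof (rule cube_eqI[of _ A n])
    have v: "vxor3 n x y z \<in> cube A n"
      using xyz by (rule vxor3_cube)
    then show cube: "f (vxor3 n x y z) \<in> cube A n" "vxor3 n (f x) (f y) (f z) \<in> cube A n"
      using xyz by (simp_all add: f_cube vxor3_cube)
    fix i assume "i < n"
    have "(\<Sum>j<n. M i j * enc2 a1 (vxor3 n x y z ! j))
        = (\<Sum>j<n. M i j * (enc2 a1 (x ! j) + enc2 a1 (y ! j) + enc2 a1 (z ! j)))"
      using enc2_xor3[OF nth_cube[OF xyz(1)] nth_cube[OF xyz(2)] nth_cube[OF xyz(3)]]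
      by (intro sum.cong) (auto simp: nth_vxor3)
    also have "\<dots> = (\<Sum>j<n. M i j * enc2 a1 (x ! j)) + (\<Sum>j<n. M i j * enc2 a1 (y ! j))
        + (\<Sum>j<n. M i j * enc2 a1 (z ! j))"
      by (simp add: distrib_left sum.distrib)
    finally have "enc2 a1 (f (vxor3 n x y z) ! i)
        = enc2 a1 (f x ! i) + enc2 a1 (f y ! i) + enc2 a1 (f z ! i)"
      using enc_f[OF v \<open>i < n\<close>] enc_f[OF xyz(1) \<open>i < n\<close>] enc_f[OF xyz(2) \<open>i < n\<close>]
        enc_f[OF xyz(3) \<open>i < n\<close>] bit_add_self[of "b i"]
      by (simp add: algebra_simps)
    also have "\<dots> = enc2 a1 (vxor3 n (f x) (f y) (f z) ! i)"
      using \<open>i < n\<close> xyz enc2_xor3[OF nth_cube nth_cube nth_cube, of "f x" n i "f y" n i "f z" n i]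
      by (simp add: nth_vxor3 f_cube)
    finally show "f (vxor3 n x y z) ! i = vxor3 n (f x) (f y) (f z) ! i"
      using cube \<open>i < n\<close> nth_cube by (intro enc2_inj) blast+
  qed
  then show "f \<in> xor3_perms A n"
    using perm by (simp add: xor3_perms_def)
qed

lemma G2_eq_AffC: "G A n 2 = AffC a0 a1 n"
  using G2_subset_xor3_perms xor3_perms_subset_G2 xor3_perms_subset_AffC AffC_subset_xor3_perms
  by blast

end

section \<open>Comparison of lower and upper bounds in each case\<close>

theorem theorem2:
  fixes A :: "'a set" and n :: nat
  assumes "finite A" and "card A \<ge> 2" and "n \<ge> 2"
  shows "G A n n = SymC A n
    \<and> (card A = 2 \<longrightarrow> (\<forall>a0 a1. A = {a0, a1} \<and> a0 \<noteq> a1 \<longrightarrow> G A n 2 = AffC a0 a1 n))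
    \<and> (card A = 2 \<and> n \<ge> 4 \<longrightarrow> G A n 3 = AltC A n \<and> G A n (n - 1) = AltC A n)
    \<and> (n \<ge> 3 \<and> card A \<ge> 3 \<and> odd (card A) \<longrightarrow>
           G A n 2 = SymC A n \<and> G A n (n - 1) = SymC A n)
    \<and> (n \<ge> 3 \<and> card A \<ge> 4 \<and> even (card A) \<longrightarrow>
           G A n 2 = AltC A n \<and> G A n (n - 1) = AltC A n)"
proof (intro conjI impI allI)
  have upper: "G A n l \<subseteq> AltC A n" if "even (card A)" "l \<le> n - 1" for l
    using G_mono[OF that(2), of n A] G_subset_AltC[of A n] assms that by auto
  have lower: "AltC A n \<subseteq> G A n l'"
    if "l \<le> l'" "\<And>x y. x \<in> cube A n \<Longrightarrow> y \<in> cube A n \<Longrightarrow> perm_group.linked (G A n l) x y" for l l'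
    using perm_group.even_mem_if_linked[OF perm_group_G[OF assms(1)] that(2)]
      G_mono[OF that(1), of n A] assms(3) by (auto simp: AltC_def)
  show "G A n n = SymC A n"
    using G_subset_SymC SymC_subset_G_full assms(1) by blast
  show "G A n 2 = AffC a0 a1 n" if "A = {a0, a1} \<and> a0 \<noteq> a1" for a0 a1
    using that binary_cube.G2_eq_AffC[of a0 a1 n] by (simp add: binary_cube_def)
  show "G A n 3 = AltC A n" "G A n (n - 1) = AltC A n" if q: "card A = 2 \<and> n \<ge> 4"
  proof -
    obtain a0 a1 where A: "A = {a0, a1}" "a0 \<noteq> a1"
      using q by (auto simp: card_2_iff)
    have "AltC A n \<subseteq> G A n l" if "3 \<le> l" for l
      using lower[OF that] G3_linked[OF A(2), of n] q A(1) by blast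
    \<comment> \<open>The bounds agree for every arity from 3 to \<open>n - 1\<close>, a range that
      is nonempty because n >= 4.\<close>
    then have eq: "G A n l = AltC A n" if "3 \<le> l" "l \<le> n - 1" for l
      using that upper[of l] q by (simp add: subset_antisym)
    show "G A n 3 = AltC A n" "G A n (n - 1) = AltC A n"
      using eq[of 3] eq[of "n - 1"] q by auto
  qed
  show "G A n 2 = SymC A n" "G A n (n - 1) = SymC A n"
    if q: "n \<ge> 3 \<and> card A \<ge> 3 \<and> odd (card A)"
  proof -
    \<comment> \<open>The odd instruction already lies in the smallest group, which turns Alt into
      Sym.\<close>
    obtain g where "g \<in> G A n 2" "\<not> evenperm g"
      using odd_mem_G[of A n 2] assms q by auto
    then have "SymC A n \<subseteq> G A n 2"
      using perm_group.all_mem_if_linked_and_odd[OF perm_group_G[OF assms(1)] G2_linked] assms q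
      by (auto simp: SymC_def)
    moreover have "G A n 2 \<subseteq> G A n (n - 1)"
      using q by (intro G_mono) auto
    ultimately show "G A n 2 = SymC A n" "G A n (n - 1) = SymC A n"
      using G_subset_SymC[OF assms(1)] by blast+
  qed
  show "G A n 2 = AltC A n" "G A n (n - 1) = AltC A n"
    if q: "n \<ge> 3 \<and> card A \<ge> 4 \<and> even (card A)"
  proof -
    have "AltC A n \<subseteq> G A n l" if "2 \<le> l" for l
      using lower[OF that] G2_linked[OF assms(1)] q by simp
    then have eq: "G A n l = AltC A n" if "2 \<le> l" "l \<le> n - 1" for l
      using that upper[of l] q by (simp add: subset_antisym)
    show "G A n 2 = AltC A n" "G A n (n - 1) = AltC A n"
      using eq[of 2] eq[of "n - 1"] q by auto
  qed
qed

end
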